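(* Let $d\ge 1$ and let $A\subseteq[0,\infty)$ have at least two elements. Assume that $\inf A=0$ or $\sup A=\infty$. Then there is a residual set $R\subseteq\Omega$ such that for every configuration $\omega\in R$ and for any $K\in\overline{\mathcal{P}_A^d}$ there exists a sequence $(t_n)_{n=1}^\infty$ of positive real numbers tending to infinity such that $$\frac{B(t_n)}{t_n}\to K$$ in the Hausdorff metric.
   Context: Let $E$ be the set of nearest neighbor edges of the lattice $\mathbb{Z}^d$ (edges join lattice points at $\ell_1$-distance $1$). The space of configurations is $\Omega=\prod_{e\in E}A$, where $A$ carries the subspace topology inherited from $\mathbb{R}$ and $\Omega$ the product topology. A subset of $\Omega$ is residual if its complement is meager, i.e. a countable union of nowhere dense sets. For a configuration $\omega=(\tau(e))_{e\in E}\in\Omega$, $\tau(e)$ is the passage time of the edge $e$; for a finite path $\Gamma$ of consecutive edges, $\tau(\Gamma)=\sum_{e\in\Gamma}\tau(e)$. For $x,y\in\mathbb{R}^d$, $T(x,y)=\inf_\Gamma\tau(\Gamma)$, the infimum being over all finite paths $\Gamma$ connecting $x'$ to $y'$, where $x',y'\in\mathbb{Z}^d$ are the unique lattice points with $x\in x'+[0,1)^d$ and $y\in y'+[0,1)^d$. $B(t)=\{x\in\mathbb{R}^d: T(0,x)\le t\}$ is the ball of radius $t$ centered at the origin in the pseudometric $T$, and $\frac{B(t)}{t}=\{x/t: x\in B(t)\}$. Convergence in the Hausdorff metric means that the Hausdorff distance $d_H(B(t_n)/t_n,K)$ tends to $0$ (the sets $B(t_n)/t_n$ need not be closed; $d_H$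 is defined by the usual formula for nonempty subsets of $\mathbb{R}^d$). $D_r$ denotes the closed $\ell_1$ ball of radius $r$ centered at $0$ in $\mathbb{R}^d$. $\mathcal{K}_A^d$ is the set of connected compact sets $K\subseteq\mathbb{R}^d$ satisfying $D_{1/\sup A}\subseteq K\subseteq D_{1/\inf A}$, where the leftmost set is replaced by $\{0\}$ if $\sup A=\infty$, and the rightmost set is replaced by $\mathbb{R}^d$ if $\inf A=0$. $\mathcal{P}_A^d$ is the set of those $K\in\mathcal{K}_A^d$ for which there exists $\alpha_K>0$ such that for each $x\in K$ there is a topological path (continuous curve) in $K$ from $0$ to $x$ of $\ell_1$-length at most $\frac{1}{\inf A}-\alpha_K$ (if $\inf A=0$, this bound is read as $+\infty$, i.e. there is no restriction on the length). $\overline{\mathcal{P}_A^d}$ is the closure of $\mathcal{P}_A^d$ in $\mathcal{K}_A^d$ with respect to the Hausdorff metric. *)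

theory Defs
  imports "HOL-Analysis.Analysis"
begin

subsection \<open>Baire category in an abstract topology\<close>

definition nowhere_dense_in :: "'a topology \<Rightarrow> 'a set \<Rightarrow> bool" where
  "nowhere_dense_in X S \<longleftrightarrow> S \<subseteq> topspace X \<and> X interior_of (X closure_of S) = {}"

definition meager_in :: "'a topology \<Rightarrow> 'a set \<Rightarrow> bool" where
  "meager_in X S \<longleftrightarrow>
     (\<exists>\<N>. countable \<N> \<and> (\<forall>N\<in>\<N>. nowhere_dense_in X N) \<and> S = \<Union>\<N>)"

definition residual_in :: "'a topology \<Rightarrow> 'a set \<Rightarrow> bool" where
  "residual_in X R \<longleftrightarrow> R \<subseteq> topspace X \<and> meager_in X (topspace X - R)"


subsection \<open>The \<open>\<ell>\<^sub>1\<close> norm, curve length, Hausdorff distance\<close>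

definition l1_norm :: "real ^ 'd::finite \<Rightarrow> real" where
  "l1_norm x = (\<Sum>i\<in>UNIV. \<bar>x $ i\<bar>)"

text \<open>The radius is extended real: \<open>l1_ball 0 = {0}\<close> and \<open>l1_ball \<infinity> = UNIV\<close>.\<close>

definition l1_ball :: "ereal \<Rightarrow> (real ^ 'd::finite) set" where
  "l1_ball r = {x. ereal (l1_norm x) \<le> r}"

text \<open>The length is the supremum over all partitions \<open>ts\<close> of the unit interval,
  the domain of library paths; it is \<open>\<infinity>\<close> for non-rectifiable curves.\<close>

definition l1_length :: "(real \<Rightarrow> real ^ 'd::finite) \<Rightarrow> ereal" where
  "l1_length g = (SUP ts\<in>{ts. sorted ts \<and> set ts \<subseteq> {0..1}}.
     ereal (\<Sum>i<length ts - 1. l1_norm (g (ts ! Suc i) - g (ts ! i))))"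

text \<open>Extended-real valued, so that unbounded sets are treated correctly; only meaningful
  for nonempty sets (as \<^const>\<open>infdist\<close> to the empty set is \<open>0\<close>).\<close>

definition hausdorff_dist :: "'a::metric_space set \<Rightarrow> 'a set \<Rightarrow> ereal" where
  "hausdorff_dist S T =
     max (SUP x\<in>S. ereal (infdist x T)) (SUP y\<in>T. ereal (infdist y S))"


subsection \<open>Configurations and passage times\<close>

text \<open>Points of the lattice are vectors of type \<^typ>\<open>int ^ 'd\<close>; an edge is
  the set of its two endpoints.\<close>

definition lattice_edges :: "(int ^ 'd::finite) set set" where
  "lattice_edges = {{x, y} | x y. (\<Sum>i\<in>UNIV. \<bar>x $ i - y $ i\<bar>) = 1}"

definition config_space :: "real set \<Rightarrow> ((int ^ 'd::finite) set \<Rightarrow> real) topology" where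
  "config_space A = product_topology (\<lambda>e. top_of_set A) lattice_edges"

text \<open>A path is the nonempty list of the vertices it visits; a single vertex is
  the path without edges.\<close>

definition lattice_path :: "(int ^ 'd::finite) list \<Rightarrow> int ^ 'd \<Rightarrow> int ^ 'd \<Rightarrow> bool" where
  "lattice_path p x y \<longleftrightarrow> p \<noteq> [] \<and> hd p = x \<and> last p = y \<and>
     (\<forall>i < length p - 1. {p ! i, p ! Suc i} \<in> lattice_edges)"

definition path_time :: "((int ^ 'd::finite) set \<Rightarrow> real) \<Rightarrow> (int ^ 'd) list \<Rightarrow> real" where
  "path_time \<omega> p = (\<Sum>i<length p - 1. \<omega> {p ! i, p ! Suc i})"

text \<open>The unique lattice point \<open>x'\<close> with \<open>x \<in> x' + [0,1)\<^sup>d\<close>.\<close>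

definition lattice_point :: "real ^ 'd::finite \<Rightarrow> int ^ 'd" where
  "lattice_point x = (\<chi> i. \<lfloor>x $ i\<rfloor>)"

definition passage_time ::
    "((int ^ 'd::finite) set \<Rightarrow> real) \<Rightarrow> real ^ 'd \<Rightarrow> real ^ 'd \<Rightarrow> real" where
  "passage_time \<omega> x y =
     (INF p\<in>{p. lattice_path p (lattice_point x) (lattice_point y)}. path_time \<omega> p)"

definition fpp_ball :: "((int ^ 'd::finite) set \<Rightarrow> real) \<Rightarrow> real \<Rightarrow> (real ^ 'd) set" where
  "fpp_ball \<omega> t = {x. passage_time \<omega> 0 x \<le> t}"


subsection \<open>The families \<open>\<K>\<close>, \<open>\<P>\<close> and the closure of \<open>\<P>\<close>\<close>

text \<open>Infimum and supremum are taken in the extended reals, where \<open>1 / 0 = \<infinity>\<close>,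
  \<open>1 / \<infinity> = 0\<close> and \<open>\<infinity> - \<alpha> = \<infinity>\<close> for real \<open>\<alpha>\<close>. Hence the inner ball is \<open>{0}\<close> if \<open>A\<close> is
  unbounded, and for infimum \<open>0\<close> the outer ball is the whole space and curve lengths
  are unrestricted.\<close>

definition K_sets :: "real set \<Rightarrow> (real ^ 'd::finite) set set" where
  "K_sets A = {K. connected K \<and> compact K \<and>
     l1_ball (1 / (SUP a\<in>A. ereal a)) \<subseteq> K \<and> K \<subseteq> l1_ball (1 / (INF a\<in>A. ereal a))}"

definition P_sets :: "real set \<Rightarrow> (real ^ 'd::finite) set set" where
  "P_sets A = {K \<in> K_sets A. \<exists>\<alpha>>0. \<forall>x\<in>K. \<exists>g.
     path g \<and> path_image g \<subseteq> K \<and> pathstart g = 0 \<and> pathfinish g = x \<and>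
     l1_length g \<le> 1 / (INF a\<in>A. ereal a) - ereal \<alpha>}"

definition P_closure :: "real set \<Rightarrow> (real ^ 'd::finite) set set" where
  "P_closure A = {K \<in> K_sets A. \<forall>\<epsilon>>0. \<exists>L\<in>P_sets A. hausdorff_dist L K < ereal \<epsilon>}"

end

(*
  Fix K in P_A and a basic open set of configurations, which constrains only edges near the
  origin. For a large time t, keep those edges, give value about inf A ("fast") to the edges close
  to t K and outside the l1 ball of radius rho t, and value sigma close to sup A ("slow") to all
  other edges of a large box. If sup A is infinite, take rho = 0 and sigma a large constant;
  otherwise inf A = 0 and rho is slightly smaller than 1 / sup A. A path in K from 0 to x of
  length l is followed in time at most about (sigma rho + l inf A) t < t, so t x lies in B(t), while
  leaving a neighbourhood of t K takes longer than t. Only finitely many edges are constrained, so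
  the configurations with B(t)/t close to K for some t >= N contain a dense open set. Replacing K
  by finite subsets of a countable dense set leaves countably many such conditions.
*)
theory Submission
  imports Defs
begin

subsection \<open>Lattice geometry and passage times\<close>

text \<open>Confinement and reachability compete for one time budget. A path that has paid about
  \<open>\<sigma> \<rho> t\<close> to reach the fast region can afterwards leave the neighbourhood
  of \<open>t K\<close> by at most about \<open>(1 / \<sigma> - \<rho>) t\<close>, so
  \<open>1 / \<sigma> - \<rho>\<close> must be small; but following a curve of length
  \<open>l\<close> needs \<open>\<sigma> \<rho> + \<eta> l < 1\<close>. The assumption on
  \<open>A\<close> reconciles the two. If \<open>A\<close> is unbounded, \<open>1 / \<sigma>\<close>
  is small already for \<open>\<rho> = 0\<close>, and the whole budget is left for the curve, where
  the gap \<open>\<alpha>\<close> yields \<open>\<eta> l < 1\<close>. If inf A = 0, then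
  \<open>\<eta> l\<close> can be made smaller than whatever \<open>\<sigma> \<rho>\<close> leaves
  over. Points reached through slow edges alone are harmless: they lie near the l1 ball of radius
  \<open>t / sup A\<close>, which \<open>t K\<close> contains. The second obstacle is that edges
  outside a finite box are arbitrary and may even cost 0. Lower bounds therefore come from a
  potential that no edge raises by more than its passage time and that is constant both near the
  origin and beyond the box.\<close>

definition lnorm :: "int ^ 'd::finite \<Rightarrow> int" where
  "lnorm v = (\<Sum>i\<in>UNIV. \<bar>v $ i\<bar>)"

definition real_vec :: "int ^ 'd::finite \<Rightarrow> real ^ 'd" where
  "real_vec v = (\<chi> i. of_int (v $ i))"

lemma lnorm_nonneg: "0 \<le> lnorm v"
  unfolding lnorm_def by (simp add: sum_nonneg)

lemma lnorm_zero [simp]: "lnorm 0 = 0"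
  unfolding lnorm_def by simp

lemma lnorm_eq_0_iff: "lnorm v = 0 \<longleftrightarrow> v = 0"
  unfolding lnorm_def by (simp add: sum_nonneg_eq_0_iff vec_eq_iff)

lemma lnorm_minus_commute: "lnorm (u - v) = lnorm (v - u)"
  unfolding lnorm_def by (simp add: abs_minus_commute)

lemma lnorm_triangle: "lnorm (u + v) \<le> lnorm u + lnorm v"
  unfolding lnorm_def by (simp flip: sum.distrib add: sum_mono abs_triangle_ineq)

lemma lnorm_diff_le: "\<bar>lnorm u - lnorm v\<bar> \<le> lnorm (u - v)"
  using lnorm_triangle[of "u - v" v] lnorm_triangle[of "v - u" u]
  by (simp add: lnorm_minus_commute)

lemma edge_iff: "{u, v} \<in> lattice_edges \<longleftrightarrow> lnorm (u - v) = 1"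
proof -
  have "lnorm (u - v) = 1" if "{u, v} = {x, y}" "lnorm (x - y) = 1" for x y
    using that by (auto simp: doubleton_eq_iff lnorm_minus_commute)
  then show ?thesis
    unfolding lattice_edges_def by (auto simp: lnorm_def)
qed

lemma edgeE:
  assumes "e \<in> lattice_edges"
  obtains u v where "e = {u, v}" "lnorm (u - v) = 1"
  using assms unfolding lattice_edges_def by (auto simp: lnorm_def)

text \<open>Move \<open>v\<close> one unit towards \<open>u\<close> in a coordinate where they
  differ. The point \<open>w\<close> is the predecessor of \<open>v\<close> on a geodesic from
  \<open>u\<close>; it drives all inductions on l1 distance below.\<close>

lemma lattice_step_towards:
  fixes u v :: "int ^ 'd::finite"
  assumes "u \<noteq> v"
  obtains w where "lnorm (w - v) = 1" "lnorm (w - u) = lnorm (v - u) - 1"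
proof -
  obtain i where i: "u $ i \<noteq> v $ i" using assms by (auto simp: vec_eq_iff)
  define c where "c = sgn (u $ i - v $ i)"
  define w where "w = v + axis i c"
  have c: "\<bar>c\<bar> = 1" using i by (simp add: c_def abs_sgn_eq)
  have split: "lnorm z = \<bar>z $ i\<bar> + (\<Sum>j\<in>UNIV - {i}. \<bar>z $ j\<bar>)" for z :: "int ^ 'd"
    unfolding lnorm_def by (subst sum.remove[of _ i]) auto
  have off: "j \<noteq> i \<Longrightarrow> w $ j = v $ j" for j by (simp add: w_def axis_def)
  have at: "w $ i = v $ i + c" by (simp add: w_def)
  have "lnorm (w - v) = 1" unfolding split using off at c by simp
  moreover have "\<bar>w $ i - u $ i\<bar> = \<bar>v $ i - u $ i\<bar> - 1"
    using i unfolding at c_def by (auto simp: sgn_if)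
  then have "lnorm (w - u) = lnorm (v - u) - 1" unfolding split using off by simp
  ultimately show thesis by (rule that)
qed

lemma finite_lnorm_le: "finite {v :: int ^ 'd::finite. lnorm v \<le> n}"
proof (rule finite_subset)
  show "{v :: int ^ 'd. lnorm v \<le> n} \<subseteq> vec_lambda ` (UNIV \<rightarrow>\<^sub>E {-n..n})"
  proof
    fix v :: "int ^ 'd" assume "v \<in> {v. lnorm v \<le> n}"
    then have "\<bar>v $ i\<bar> \<le> n" for i
      using member_le_sum[of i UNIV "\<lambda>i. \<bar>v $ i\<bar>"] by (simp add: lnorm_def)
    then have "(\<lambda>i. v $ i) \<in> UNIV \<rightarrow>\<^sub>E {-n..n}" by (auto simp: abs_le_iff minus_le_iff)
    then show "v \<in> vec_lambda ` (UNIV \<rightarrow>\<^sub>E {-n..n})"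
      by (metis (no_types) image_eqI vec_nth_inverse)
  qed
qed (auto intro!: finite_imageI finite_PiE)

definition ball_edges :: "int \<Rightarrow> (int ^ 'd::finite) set set" where
  "ball_edges n = {e \<in> lattice_edges. \<forall>v\<in>e. lnorm v \<le> n}"

lemma finite_ball_edges: "finite (ball_edges n :: (int ^ 'd::finite) set set)"
proof (rule finite_subset)
  show "(ball_edges n :: (int ^ 'd) set set) \<subseteq> Pow {v. lnorm v \<le> n}"
    by (auto simp: ball_edges_def)
qed (simp add: finite_lnorm_le)

lemma ball_edges_subset: "ball_edges n \<subseteq> lattice_edges"
  by (auto simp: ball_edges_def)

lemma finite_edges_subset_ball:
  assumes "finite E" "E \<subseteq> (lattice_edges :: (int ^ 'd::finite) set set)"
  obtains n where "0 \<le> n" "E \<subseteq> ball_edges n"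
proof -
  have "finite (\<Union>E)" using assms by (auto elim!: edgeE)
  then have "bdd_above (lnorm ` \<Union>E)" by simp
  then obtain n where n: "\<And>v. v \<in> \<Union>E \<Longrightarrow> lnorm v \<le> n"
    by (meson bdd_above.E imageI)
  have "E \<subseteq> ball_edges (max 0 n)" using assms(2) n by (fastforce simp: ball_edges_def)
  then show thesis by (intro that[of "max 0 n"]) auto
qed

section \<open>Comparison of norms, and rounding errors between the lattice and real space\<close>

lemma l1_norm_real_vec: "l1_norm (real_vec v) = of_int (lnorm v)"
  by (simp add: l1_norm_def real_vec_def lnorm_def)

lemma l1_norm_scaleR: "l1_norm (c *\<^sub>R x) = \<bar>c\<bar> * l1_norm x"
  by (simp add: l1_norm_def abs_mult sum_distrib_left)

lemma norm_le_l1_norm: "norm x \<le> l1_norm x"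
  unfolding l1_norm_def by (rule norm_le_l1_cart)

lemma l1_norm_le_norm:
  fixes x :: "real ^ 'd::finite"
  shows "l1_norm x \<le> real CARD('d) * norm x"
  unfolding l1_norm_def
  using sum_bounded_above[of UNIV "\<lambda>i. \<bar>x $ i\<bar>" "norm x"] by (simp add: component_le_norm_cart)

lemma l1_norm_nonneg: "0 \<le> l1_norm x"
  unfolding l1_norm_def by (simp add: sum_nonneg)

lemma lattice_point_zero [simp]: "lattice_point 0 = 0"
  by (simp add: lattice_point_def vec_eq_iff)

lemma dist_lattice_point:
  fixes x :: "real ^ 'd::finite"
  shows "dist (real_vec (lattice_point x)) x \<le> real CARD('d)"
proof -
  have "l1_norm (real_vec (lattice_point x) - x) \<le> real CARD('d)"
    unfolding l1_norm_def
    using sum_bounded_above[of UNIV "\<lambda>i. \<bar>(real_vec (lattice_point x) - x) $ i\<bar>" 1]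
    by (simp add: real_vec_def lattice_point_def) linarith
  then show ?thesis using norm_le_l1_norm order_trans unfolding dist_norm by blast
qed

lemma lnorm_lattice_point_diff:
  fixes x y :: "real ^ 'd::finite"
  shows "of_int (lnorm (lattice_point x - lattice_point y)) \<le> l1_norm (x - y) + real CARD('d)"
proof -
  have "\<bar>of_int \<lfloor>a\<rfloor> - of_int \<lfloor>b\<rfloor>\<bar> \<le> \<bar>a - b\<bar> + (1::real)" for a b :: real by linarith
  then have "(\<Sum>i\<in>(UNIV::'d set). \<bar>of_int \<lfloor>x $ i\<rfloor> - of_int \<lfloor>y $ i\<rfloor>\<bar>) \<le> (\<Sum>i\<in>UNIV. \<bar>x $ i - y $ i\<bar> + (1::real))"
    by (intro sum_mono) blast
  then show ?thesis by (simp add: lnorm_def lattice_point_def l1_norm_def sum.distrib)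
qed

lemma dist_real_vec_le: "dist (real_vec u) (real_vec v) \<le> of_int (lnorm (u - v))"
proof -
  have "real_vec u - real_vec v = real_vec (u - v)" by (simp add: real_vec_def vec_eq_iff)
  then show ?thesis
    using norm_le_l1_norm[of "real_vec (u - v)"] by (simp add: dist_norm l1_norm_real_vec)
qed

section \<open>Passage times from the origin to lattice vertices\<close>

definition vertex_time :: "((int ^ 'd::finite) set \<Rightarrow> real) \<Rightarrow> int ^ 'd \<Rightarrow> real" where
  "vertex_time \<omega> v = (INF p\<in>{p. lattice_path p 0 v}. path_time \<omega> p)"

text \<open>\<open>B(t)\<close> is a union of half-open unit cubes, so all estimates can be made at
  vertices, at the price of a rounding error bounded by the dimension.\<close>

lemma fpp_ball_eq: "fpp_ball \<omega> t = {x. vertex_time \<omega> (lattice_point x) \<le> t}"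
  by (simp add: fpp_ball_def passage_time_def vertex_time_def)

lemma lattice_path_single: "lattice_path [v] v v"
  by (simp add: lattice_path_def)

lemma lattice_path_snoc:
  assumes "lattice_path p x u" "lnorm (u - v) = 1"
  shows "lattice_path (p @ [v]) x v" "path_time \<omega> (p @ [v]) = path_time \<omega> p + \<omega> {u, v}"
proof -
  have p: "p \<noteq> []" "hd p = x" "p ! (length p - 1) = u"
    "\<And>i. i < length p - 1 \<Longrightarrow> {p ! i, p ! Suc i} \<in> lattice_edges"
    using assms by (auto simp: lattice_path_def last_conv_nth)
  obtain n where n: "length p = Suc n" using p(1) by (cases p) auto
  show "lattice_path (p @ [v]) x v"
    unfolding lattice_path_def using p n assms(2)
    by (auto simp: nth_append edge_iff less_Suc_eq)
  show "path_time \<omega> (p @ [v]) = path_time \<omega> p + \<omega> {u, v}"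
    unfolding path_time_def using p n by (simp add: nth_append)
qed

text \<open>The infimum in \<open>vertex_time\<close> is a real one and says nothing over an empty
  set; this nonemptiness is what permits bounding it from below.\<close>

lemma lattice_path_exists: "\<exists>p. lattice_path p 0 v"
proof (induction "nat (lnorm v)" arbitrary: v)
  case 0
  then have "v = 0" using lnorm_nonneg[of v] by (simp add: lnorm_eq_0_iff[symmetric])
  then show ?case using lattice_path_single by blast
next
  case (Suc n)
  then have "0 \<noteq> v" by auto
  then obtain w where w: "lnorm (w - v) = 1" "lnorm (w - 0) = lnorm (v - 0) - 1"
    by (rule lattice_step_towards)
  then have "n = nat (lnorm w)" using Suc(2) by simp
  then obtain p where "lattice_path p 0 w" using Suc(1) by blast
  then show ?case using lattice_path_snoc w by blast
qed

lemma path_time_nonneg: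
  assumes "\<And>e. e \<in> lattice_edges \<Longrightarrow> 0 \<le> \<omega> e" "lattice_path p x y"
  shows "0 \<le> path_time \<omega> p"
  using assms unfolding path_time_def lattice_path_def by (intro sum_nonneg) auto

text \<open>Nonnegative passage times give the lower bound 0 without which the real infimum need not
  lie below its members.\<close>

lemma vertex_time_le_path_time:
  assumes "\<And>e. e \<in> lattice_edges \<Longrightarrow> 0 \<le> \<omega> e" "lattice_path p 0 v"
  shows "vertex_time \<omega> v \<le> path_time \<omega> p"
  unfolding vertex_time_def using assms
  by (intro cINF_lower bdd_belowI[of _ 0]) (auto intro: path_time_nonneg)

lemma vertex_time_zero:
  assumes "\<And>e. e \<in> lattice_edges \<Longrightarrow> 0 \<le> \<omega> e"
  shows "vertex_time \<omega> 0 \<le> 0"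
  using vertex_time_le_path_time[OF assms lattice_path_single] by (simp add: path_time_def)

lemma vertex_time_step:
  assumes "\<And>e. e \<in> lattice_edges \<Longrightarrow> 0 \<le> \<omega> e" "lnorm (u - v) = 1"
  shows "vertex_time \<omega> v \<le> vertex_time \<omega> u + \<omega> {u, v}"
proof -
  have "vertex_time \<omega> v - \<omega> {u, v} \<le> path_time \<omega> p" if "lattice_path p 0 u" for p
    using vertex_time_le_path_time[of \<omega>, OF assms(1) lattice_path_snoc(1)[OF that assms(2)]]
      lattice_path_snoc(2)[OF that assms(2), of \<omega>] by simp
  then have "vertex_time \<omega> v - \<omega> {u, v} \<le> vertex_time \<omega> u"
    unfolding vertex_time_def[of \<omega> u] using lattice_path_exists[of u]
    by (intro cINF_greatest) auto
  then show ?thesis by linarith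
qed

text \<open>Weak duality for shortest paths: the increments of \<open>f\<close> telescope along any
  path and each is paid for by its edge. The hypothesis covers both orientations of an edge.\<close>

lemma potential_le_vertex_time:
  assumes "\<And>u v. lnorm (u - v) = 1 \<Longrightarrow> f v - f u \<le> \<omega> {u, v}"
  shows "f v - f 0 \<le> vertex_time \<omega> v"
proof -
  have "f v - f 0 \<le> path_time \<omega> p" if "lattice_path p 0 v" for p
  proof -
    have p: "p \<noteq> []" "p ! 0 = 0" "p ! (length p - 1) = v"
      "\<And>i. i < length p - 1 \<Longrightarrow> lnorm (p ! i - p ! Suc i) = 1"
      using that by (auto simp: lattice_path_def last_conv_nth hd_conv_nth edge_iff)
    have "f v - f 0 = (\<Sum>i<length p - 1. f (p ! Suc i) - f (p ! i))"
      using p sum_lessThan_telescope[of "\<lambda>i. f (p ! i)"] by simp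
    also have "\<dots> \<le> path_time \<omega> p"
      unfolding path_time_def using p(4) assms by (intro sum_mono) auto
    finally show ?thesis .
  qed
  then show ?thesis
    unfolding vertex_time_def using lattice_path_exists[of v] by (intro cINF_greatest) auto
qed

subsection \<open>Bounds on passage times\<close>

text \<open>\<open>R\<close> will be \<open>\<rho> * t\<close> and \<open>S\<close> the set
  \<open>t K\<close>. Both endpoints are tested so that the potential used for the lower bound takes
  equal values at the two ends of a fast edge.\<close>

definition fast_edges :: "(real ^ 'd::finite) set \<Rightarrow> real \<Rightarrow> real \<Rightarrow> (int ^ 'd) set set" where
  "fast_edges S R \<delta> = {e \<in> lattice_edges. \<forall>v\<in>e. R \<le> of_int (lnorm v) \<and> infdist (real_vec v) S \<le> \<delta>}"

text \<open>Slow edges allow speed at most \<open>1 / \<sigma>\<close>. Fast edges may be free, but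
  they are reached only at radius \<open>R\<close> and never lead farther than
  \<open>\<delta>\<close> from \<open>S\<close>; whatever exceeds these is again paid at rate
  \<open>\<sigma>\<close>. Edges in the ball of radius \<open>M\<close> may be free too, hence the
  summand \<open>M\<close>. The bound \<open>L\<close> depends on neither \<open>\<omega>\<close>
  nor \<open>n\<close>, so values outside the box stay arbitrary.\<close>

lemma vertex_time_lower_bound:
  fixes S :: "(real ^ 'd::finite) set"
  assumes S: "S \<noteq> {}" "bounded S" and pos: "0 < \<sigma>" "0 \<le> M" "0 \<le> t"
  obtains L where
    "\<And>n \<omega> v. \<lbrakk>L \<le> n; \<And>e. e \<in> lattice_edges \<Longrightarrow> 0 \<le> \<omega> e;
       \<And>e. \<lbrakk>e \<in> ball_edges n; e \<notin> ball_edges M; e \<notin> fast_edges S R \<delta>\<rbrakk> \<Longrightarrow> \<sigma> \<le> \<omega> e;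
       vertex_time \<omega> v \<le> t\<rbrakk> \<Longrightarrow>
       of_int (lnorm v) \<le> t / \<sigma> + of_int M \<or> infdist (real_vec v) S \<le> \<delta> + t / \<sigma> + of_int M - R"
proof -
  obtain b where b: "\<And>y. y \<in> S \<Longrightarrow> norm y \<le> b" using S(2) by (auto simp: bounded_iff)
  \<comment> \<open>The potential \<open>f\<close> grows by at most \<open>\<omega> e\<close> across every edge \<open>e\<close>: truncation
    from below at \<open>c\<close> makes it constant on the ball of radius \<open>M\<close>, truncation from above at \<open>cap\<close>
    makes it constant far away, and \<open>h\<close> equals \<open>R\<close> at both ends of a fast edge.\<close>
  define c where "c = \<sigma> * of_int M"
  define cap where "cap = t + c + 1"
  define h where "h v = min (of_int (lnorm v)) (R + max 0 (infdist (real_vec v) S - \<delta>))" for v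
  define f where "f v = min cap (max c (\<sigma> * h v))" for v
  \<comment> \<open>From norm \<open>L - 1\<close> on, both terms of the minimum in \<open>h\<close>
    are at least \<open>cap / \<sigma>\<close>. The factor \<open>CARD('d)\<close> converts the l1
    norm to the Euclidean norm, and \<open>b\<close> bounds \<open>S\<close>. Hence \<open>f\<close>
    equals \<open>cap\<close> at both ends of every edge outside
    \<open>ball_edges n\<close>.\<close>
  define L where "L = \<lceil>cap / \<sigma> + 1 + real CARD('d) * (cap / \<sigma> + \<bar>R\<bar> + \<bar>\<delta>\<bar> + b)\<rceil> + 1"
  have c0: "0 \<le> c" using pos by (simp add: c_def)
  have cap0: "0 \<le> cap" using pos c0 by (simp add: cap_def)
  have h1: "\<bar>h u - h v\<bar> \<le> 1" if "lnorm (u - v) = 1" for u v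
  proof -
    have "\<bar>infdist (real_vec u) S - infdist (real_vec v) S\<bar> \<le> 1"
      using infdist_triangle_abs[of "real_vec u" S "real_vec v"] dist_real_vec_le[of u v] that by simp
    moreover have "\<bar>lnorm u - lnorm v\<bar> \<le> 1" using lnorm_diff_le[of u v] that by simp
    then have "\<bar>of_int (lnorm u) - of_int (lnorm v)\<bar> \<le> (1::real)"
      by (metis of_int_1_le_iff of_int_abs of_int_diff of_int_le_1_iff)
    ultimately show ?thesis unfolding h_def by linarith
  qed
  have far: "f v = cap" if v: "L - 1 \<le> lnorm v" for v
  proof -
    have Lv: "cap / \<sigma> + 1 + real CARD('d) * (cap / \<sigma> + \<bar>R\<bar> + \<bar>\<delta>\<bar> + b) \<le> of_int (lnorm v)"
      using v unfolding L_def by linarith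
    obtain y where "y \<in> S" using S by auto
    then have "0 \<le> b" using b[of y] norm_ge_zero[of y] by linarith
    then have "0 \<le> real CARD('d) * (cap / \<sigma> + \<bar>R\<bar> + \<bar>\<delta>\<bar> + b)"
      using cap0 pos by simp
    then have 1: "cap / \<sigma> \<le> of_int (lnorm v)" using Lv by linarith
    have "real CARD('d) * (cap / \<sigma> + \<bar>R\<bar> + \<bar>\<delta>\<bar> + b) \<le> of_int (lnorm v)"
      using Lv cap0 pos by (smt (verit) divide_nonneg_nonneg)
    also have "\<dots> \<le> real CARD('d) * norm (real_vec v)"
      using l1_norm_le_norm[of "real_vec v"] by (simp add: l1_norm_real_vec)
    finally have n: "cap / \<sigma> + \<bar>R\<bar> + \<bar>\<delta>\<bar> + b \<le> norm (real_vec v)"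
      by simp
    have "norm (real_vec v) - b \<le> infdist (real_vec v) S"
      unfolding infdist_notempty[OF S(1)]
    proof (rule cINF_greatest[OF S(1)])
      fix y assume "y \<in> S"
      then show "norm (real_vec v) - b \<le> dist (real_vec v) y"
        using b[of y] norm_triangle_ineq2[of "real_vec v" y] by (simp add: dist_norm)
    qed
    then have "cap / \<sigma> \<le> h v" using n 1 unfolding h_def by linarith
    then have "cap \<le> \<sigma> * h v" using pos by (simp add: field_simps)
    then show ?thesis by (simp add: f_def)
  qed
  show thesis
  proof (rule that[of L])
    fix n \<omega> and v :: "int ^ 'd"
    assume n: "L \<le> n" and nonneg: "\<And>e. e \<in> lattice_edges \<Longrightarrow> 0 \<le> \<omega> e"
      and slow: "\<And>e. \<lbrakk>e \<in> ball_edges n; e \<notin> ball_edges M; e \<notin> fast_edges S R \<delta>\<rbrakk> \<Longrightarrow> \<sigma> \<le> \<omega> e"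
      and v: "vertex_time \<omega> v \<le> t"
    have "f w - f u \<le> \<omega> {u, w}" if uw: "lnorm (u - w) = 1" for u w
    proof -
      have e: "{u, w} \<in> lattice_edges" using uw edge_iff by blast
      have uw': "\<bar>lnorm u - lnorm w\<bar> \<le> 1" using lnorm_diff_le[of u w] uw by simp
      consider "{u, w} \<notin> ball_edges n" | "{u, w} \<in> ball_edges M" | "{u, w} \<in> fast_edges S R \<delta>"
        | "{u, w} \<in> ball_edges n" "{u, w} \<notin> ball_edges M" "{u, w} \<notin> fast_edges S R \<delta>" by blast
      then show ?thesis
      proof cases
        case 1
        then have "n < lnorm u \<or> n < lnorm w" using e by (auto simp: ball_edges_def)
        then have "f u = cap" "f w = cap" using uw' n by (auto intro!: far)
        then show ?thesis using nonneg[OF e] by simp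
      next
        case 2
        then have "lnorm u \<le> M" "lnorm w \<le> M" by (auto simp: ball_edges_def)
        then have "h u \<le> of_int M" "h w \<le> of_int M" by (auto simp: h_def min_le_iff_disj)
        then have "\<sigma> * h u \<le> c" "\<sigma> * h w \<le> c" using pos by (auto simp: c_def)
        then show ?thesis using nonneg[OF e] by (simp add: f_def)
      next
        case 3
        then have "h u = R" "h w = R" by (auto simp: h_def fast_edges_def)
        then show ?thesis using nonneg[OF e] by (simp add: f_def)
      next
        case 4
        have "h w \<le> h u + 1" using h1[OF uw] by linarith
        then have "\<sigma> * h w \<le> \<sigma> * (h u + 1)" using pos by (intro mult_left_mono) auto
        then have "f w - f u \<le> \<sigma>" unfolding f_def using pos(1) by (simp add: distrib_left)
        then show ?thesis using slow[OF 4] by linarith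
      qed
    qed
    then have "f v - f 0 \<le> t" using potential_le_vertex_time[of f \<omega> v] v by force
    moreover have "\<sigma> * h 0 \<le> 0" using pos by (auto simp: h_def mult_le_0_iff)
    then have "f 0 \<le> c" using c0 by (simp add: f_def)
    ultimately have "f v \<le> t + c" by linarith
    \<comment> \<open>Since \<open>t + c < cap\<close>, the bound on \<open>f v\<close> cannot come
      from the upper truncation and so passes to \<open>\<sigma> * h v\<close>.\<close>
    then have "\<sigma> * h v \<le> t + c" by (simp add: f_def cap_def min_le_iff_disj)
    then have "h v \<le> t / \<sigma> + of_int M" using pos by (simp add: c_def field_simps)
    then show "of_int (lnorm v) \<le> t / \<sigma> + of_int M \<or> infdist (real_vec v) S \<le> \<delta> + t / \<sigma> + of_int M - R"
      unfolding h_def by linarith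
  qed
qed

text \<open>A geodesic from the origin stays in every l1 ball around the origin that contains its
  endpoint. Its edges in the ball of radius \<open>M\<close> cost at most \<open>c * M\<close>
  together, the others at most \<open>\<sigma>\<close> each.\<close>

lemma vertex_time_ball_le:
  assumes nonneg: "\<And>e. e \<in> lattice_edges \<Longrightarrow> 0 \<le> \<omega> e"
    and pos: "0 \<le> M" "0 \<le> c" "0 \<le> \<sigma>"
    and inner: "\<And>e. e \<in> ball_edges M \<Longrightarrow> \<omega> e \<le> c"
    and outer: "\<And>e. \<lbrakk>e \<in> ball_edges n; e \<notin> ball_edges M\<rbrakk> \<Longrightarrow> \<omega> e \<le> \<sigma>"
  shows "lnorm v \<le> n \<Longrightarrow> vertex_time \<omega> v \<le> c * of_int M + \<sigma> * of_int (lnorm v)"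
    and "lnorm v \<le> M \<Longrightarrow> vertex_time \<omega> v \<le> c * of_int M"
proof -
  have in_M: "vertex_time \<omega> v \<le> c * of_int (lnorm v)" if "lnorm v \<le> M" for v
    using that
  proof (induction "nat (lnorm v)" arbitrary: v)
    case 0
    then have "v = 0" using lnorm_nonneg[of v] by (simp add: lnorm_eq_0_iff[symmetric])
    then show ?case using vertex_time_zero[of \<omega>] nonneg by simp
  next
    case (Suc k)
    then have "0 \<noteq> v" by auto
    then obtain w where w: "lnorm (w - v) = 1" "lnorm (w - 0) = lnorm (v - 0) - 1"
      by (rule lattice_step_towards)
    then have "vertex_time \<omega> w \<le> c * of_int (lnorm w)" using Suc(1)[of w] Suc(2,3) by simp
    moreover have "\<omega> {w, v} \<le> c"
      using w Suc(3) by (intro inner) (auto simp: ball_edges_def edge_iff)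
    moreover have "lnorm v = lnorm w + 1" using w by simp
    ultimately show ?case using vertex_time_step[of \<omega> w v] nonneg w(1) by (simp add: distrib_left)
  qed
  show M: "vertex_time \<omega> v \<le> c * of_int M" if "lnorm v \<le> M" for v
    by (rule order_trans[OF in_M[OF that] mult_left_mono]) (use that pos in auto)
  show "vertex_time \<omega> v \<le> c * of_int M + \<sigma> * of_int (lnorm v)" if "lnorm v \<le> n"
    using that
  proof (induction "nat (lnorm v)" arbitrary: v)
    case 0
    then have "v = 0" using lnorm_nonneg[of v] by (simp add: lnorm_eq_0_iff[symmetric])
    then show ?case using M[of 0] pos by simp
  next
    case (Suc k)
    show ?case
    proof (cases "lnorm v \<le> M")
      case True
      then show ?thesis using M[of v] pos lnorm_nonneg[of v]
        by (smt (verit) of_int_0_le_iff mult_nonneg_nonneg)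
    next
      case False
      have "0 \<noteq> v" using Suc(2) by auto
      then obtain w where w: "lnorm (w - v) = 1" "lnorm (w - 0) = lnorm (v - 0) - 1"
        by (rule lattice_step_towards)
      then have "vertex_time \<omega> w \<le> c * of_int M + \<sigma> * of_int (lnorm w)" using Suc(1)[of w] Suc(2,3) by simp
      moreover have "\<omega> {w, v} \<le> \<sigma>"
        using w Suc(3) False by (intro outer) (auto simp: ball_edges_def edge_iff)
      moreover have "lnorm v = lnorm w + 1" using w by simp
      ultimately show ?thesis using vertex_time_step[of \<omega> w v] nonneg w(1) by (simp add: distrib_left)
    qed
  qed
qed

text \<open>The maximum with \<open>C\<close> is the right invariant: a step either ends at a vertex
  known by another route to have time at most \<open>C\<close>, or adds at most
  \<open>\<eta>\<close> to the time of its start. In both cases the maximum grows by at most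
  \<open>\<eta>\<close> along a geodesic from \<open>u\<close> to \<open>v\<close>, which stays in
  the l1 ball assumed to lie in \<open>W\<close>.\<close>

lemma vertex_time_walk_le:
  assumes step: "\<And>u v. \<lbrakk>lnorm (u - v) = 1; u \<in> W; v \<in> W\<rbrakk> \<Longrightarrow> vertex_time \<omega> v \<le> max C (vertex_time \<omega> u + \<eta>)"
    and "0 \<le> \<eta>" and W: "\<And>w. lnorm (w - u) \<le> lnorm (v - u) \<Longrightarrow> w \<in> W"
  shows "max C (vertex_time \<omega> v) \<le> max C (vertex_time \<omega> u) + \<eta> * of_int (lnorm (v - u))"
  using W
proof (induction "nat (lnorm (v - u))" arbitrary: v)
  case 0
  then have "v = u" using lnorm_nonneg[of "v - u"] lnorm_eq_0_iff[of "v - u"] by simp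
  then show ?case by simp
next
  case (Suc k)
  then have "u \<noteq> v" by auto
  then obtain w where w: "lnorm (w - v) = 1" "lnorm (w - u) = lnorm (v - u) - 1"
    by (rule lattice_step_towards)
  have "max C (vertex_time \<omega> w) \<le> max C (vertex_time \<omega> u) + \<eta> * of_int (lnorm (w - u))"
    by (rule Suc(1)) (use Suc(2,3) w in auto)
  moreover have "vertex_time \<omega> v \<le> max C (vertex_time \<omega> w + \<eta>)"
    using Suc(3) w by (intro step) auto
  ultimately show ?case using w \<open>0 \<le> \<eta>\<close> by (simp add: algebra_simps) linarith
qed

lemma vertex_time_polygon_le:
  assumes "\<And>u v. \<lbrakk>lnorm (u - v) = 1; u \<in> W; v \<in> W\<rbrakk> \<Longrightarrow> vertex_time \<omega> v \<le> max C (vertex_time \<omega> u + \<eta>)"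
    and "0 \<le> \<eta>" and "vertex_time \<omega> (q 0) \<le> C"
    and "\<And>i w. \<lbrakk>i < m; lnorm (w - q i) \<le> lnorm (q (Suc i) - q i)\<rbrakk> \<Longrightarrow> w \<in> W"
  shows "vertex_time \<omega> (q m) \<le> C + \<eta> * (\<Sum>i<m. of_int (lnorm (q (Suc i) - q i)))"
proof -
  have "k \<le> m \<Longrightarrow> max C (vertex_time \<omega> (q k)) \<le> C + \<eta> * (\<Sum>i<k. of_int (lnorm (q (Suc i) - q i)))" for k
  proof (induction k)
    case 0
    then show ?case using assms(3) by simp
  next
    case (Suc k)
    then show ?case
      using vertex_time_walk_le[of W \<omega> C \<eta> "q k" "q (Suc k)"] assms(1,2) assms(4)[of k]
      by (auto simp: distrib_left)
  qed
  from this[of m] show ?thesis by simp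
qed

section \<open>From vertex times to the rescaled ball\<close>

lemma l1_ball_retract:
  fixes x :: "real ^ 'd::finite"
  assumes "0 \<le> r" "0 \<le> \<delta>" "l1_norm x \<le> r + \<delta>"
  obtains y where "l1_norm y \<le> r" "dist x y \<le> \<delta>"
proof (cases "l1_norm x \<le> r")
  case True
  then show thesis using assms by (intro that[of x]) auto
next
  case False
  define y where "y = (r / l1_norm x) *\<^sub>R x"
  have pos: "0 < l1_norm x" using False assms by linarith
  have "x - y = (1 - r / l1_norm x) *\<^sub>R x" by (simp add: y_def algebra_simps)
  then have "l1_norm (x - y) = \<bar>1 - r / l1_norm x\<bar> * l1_norm x" by (simp add: l1_norm_scaleR)
  also have "\<dots> = l1_norm x - r" using False pos by (simp add: field_simps)
  finally have "dist x y \<le> \<delta>" using norm_le_l1_norm[of "x - y"] assms by (simp add: dist_norm)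
  moreover have "l1_norm y \<le> r" using pos assms by (simp add: y_def l1_norm_scaleR)
  ultimately show thesis by (intro that)
qed

lemma dist_divide_scaleR:
  fixes x y :: "'a::real_normed_vector"
  assumes "0 < t"
  shows "dist (x /\<^sub>R t) y = dist x (t *\<^sub>R y) / (t::real)"
proof -
  have "x /\<^sub>R t - y = (x - t *\<^sub>R y) /\<^sub>R t" using assms by (simp add: algebra_simps)
  then show ?thesis using assms by (simp add: dist_norm divide_inverse_commute)
qed

text \<open>The two alternatives of the lower bound both end near \<open>K\<close>. Small
  \<open>lnorm v\<close> means rescaled l1 norm at most \<open>r + 2 * \<epsilon>\<close>, and
  radial retraction lands in the l1 ball of radius \<open>r\<close> inside \<open>K\<close>.
  Otherwise the distance to \<open>t K\<close> is at most \<open>4 * \<epsilon> * t\<close>: twice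
  \<open>\<epsilon> * t\<close> from the width of the fast region, once from
  \<open>1 / \<sigma> - \<rho>\<close>, once from \<open>M\<close>. Choosing a nearby point and
  rounding \<open>x\<close> add one \<open>\<epsilon>\<close> each.\<close>

lemma fpp_ball_near:
  fixes K :: "(real ^ 'd::finite) set"
  assumes K: "0 \<in> K" "bounded K" "\<And>x. l1_norm x \<le> r \<Longrightarrow> x \<in> K"
    and pos: "0 < \<epsilon>" "0 \<le> r" "0 < \<sigma>" "0 \<le> M" "0 < t"
    and par: "1 / \<sigma> \<le> r + \<epsilon>" "1 / \<sigma> - \<rho> \<le> \<epsilon>" "of_int M \<le> \<epsilon> * t" "real CARD('d) \<le> \<epsilon> * t"
  obtains L where
    "\<forall>n\<ge>L. \<forall>\<omega>. (\<forall>e\<in>lattice_edges. 0 \<le> \<omega> e) \<longrightarrow>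
       (\<forall>e \<in> ball_edges n - ball_edges M - fast_edges ((*\<^sub>R) t ` K) (\<rho> * t) (2 * \<epsilon> * t). \<sigma> \<le> \<omega> e) \<longrightarrow>
       (\<forall>x \<in> fpp_ball \<omega> t. \<exists>y\<in>K. dist (x /\<^sub>R t) y \<le> 6 * \<epsilon>)"
proof -
  have "(*\<^sub>R) t ` K \<noteq> {}" "bounded ((*\<^sub>R) t ` K)" using K by (auto intro: bounded_scaling)
  from vertex_time_lower_bound[OF this pos(3,4) less_imp_le[OF pos(5)]]
  obtain L where L: "\<And>n \<omega> v. \<lbrakk>L \<le> n; \<And>e. e \<in> lattice_edges \<Longrightarrow> 0 \<le> \<omega> e;
       \<And>e. \<lbrakk>e \<in> ball_edges n; e \<notin> ball_edges M;
         e \<notin> fast_edges ((*\<^sub>R) t ` K) (\<rho> * t) (2 * \<epsilon> * t)\<rbrakk> \<Longrightarrow> \<sigma> \<le> \<omega> e; vertex_time \<omega> v \<le> t\<rbrakk> \<Longrightarrow>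
       of_int (lnorm v) \<le> t / \<sigma> + of_int M \<or>
       infdist (real_vec v) ((*\<^sub>R) t ` K) \<le> 2 * \<epsilon> * t + t / \<sigma> + of_int M - \<rho> * t"
    by metis
  show thesis
  proof (rule that[of L], intro allI impI ballI)
    fix n \<omega> and x :: "real ^ 'd"
    assume n: "L \<le> n" and nonneg: "\<forall>e\<in>lattice_edges. 0 \<le> \<omega> e"
      and slow: "\<forall>e \<in> ball_edges n - ball_edges M - fast_edges ((*\<^sub>R) t ` K) (\<rho> * t) (2 * \<epsilon> * t). \<sigma> \<le> \<omega> e"
      and x: "x \<in> fpp_ball \<omega> t"
    define v where "v = lattice_point x"
    have dvx: "dist x (real_vec v) \<le> \<epsilon> * t"
      using dist_lattice_point[of x] par(4) unfolding v_def by (simp add: dist_commute)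
    have "vertex_time \<omega> v \<le> t" using x by (simp add: fpp_ball_eq v_def)
    then have "of_int (lnorm v) \<le> t / \<sigma> + of_int M \<or>
      infdist (real_vec v) ((*\<^sub>R) t ` K) \<le> 2 * \<epsilon> * t + t / \<sigma> + of_int M - \<rho> * t"
      using L[OF n, of \<omega> v] nonneg slow by simp
    then obtain y where y: "y \<in> K" "dist (real_vec v) (t *\<^sub>R y) \<le> 5 * \<epsilon> * t"
    proof
      assume a: "of_int (lnorm v) \<le> t / \<sigma> + of_int M"
      have "l1_norm (real_vec v /\<^sub>R t) = of_int (lnorm v) / t"
        using pos by (simp add: l1_norm_scaleR l1_norm_real_vec divide_inverse_commute)
      also have "\<dots> \<le> (t / \<sigma> + \<epsilon> * t) / t" using a par(3) pos by (intro divide_right_mono) auto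
      also have "\<dots> = 1 / \<sigma> + \<epsilon>" using pos by (simp add: field_simps)
      finally have "l1_norm (real_vec v /\<^sub>R t) \<le> r + 2 * \<epsilon>" using par(1) by linarith
      then obtain y where y: "l1_norm y \<le> r" "dist (real_vec v /\<^sub>R t) y \<le> 2 * \<epsilon>"
        using pos by (auto elim: l1_ball_retract[rotated 2])
      have "dist (real_vec v) (t *\<^sub>R y) \<le> 2 * \<epsilon> * t"
        using y(2) pos by (simp add: dist_divide_scaleR pos_divide_le_eq)
      also have "2 * \<epsilon> * t \<le> 5 * \<epsilon> * t" using pos by simp
      finally show thesis using K(3)[OF y(1)] by (intro that[of y])
    next
      assume a: "infdist (real_vec v) ((*\<^sub>R) t ` K) \<le> 2 * \<epsilon> * t + t / \<sigma> + of_int M - \<rho> * t"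
      have "(1 / \<sigma> - \<rho>) * t \<le> \<epsilon> * t" using par(2) pos by (intro mult_right_mono) auto
      then have "infdist (real_vec v) ((*\<^sub>R) t ` K) \<le> 4 * \<epsilon> * t"
        using a par(3) by (simp add: algebra_simps)
      \<comment> \<open>\<open>K\<close> is only bounded here, so the infimum need not be attained;
        a strict bound supplies a witness.\<close>
      also have "\<dots> < 5 * \<epsilon> * t" using pos by simp
      finally have "(INF z\<in>(*\<^sub>R) t ` K. dist (real_vec v) z) < 5 * \<epsilon> * t"
        using K(1) by (subst infdist_notempty[symmetric]) auto
      then obtain z where "z \<in> (*\<^sub>R) t ` K" "dist (real_vec v) z < 5 * \<epsilon> * t"
        using K(1) by (subst (asm) cINF_less_iff) (auto intro!: bdd_belowI[of _ 0])
      then show thesis using that by auto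
    qed
    have "dist x (t *\<^sub>R y) \<le> 6 * \<epsilon> * t"
      using dist_triangle[of x "t *\<^sub>R y" "real_vec v"] dvx y(2) by linarith
    then have "dist (x /\<^sub>R t) y \<le> 6 * \<epsilon>"
      using pos by (simp add: dist_divide_scaleR pos_divide_le_eq)
    then show "\<exists>y\<in>K. dist (x /\<^sub>R t) y \<le> 6 * \<epsilon>" using y by blast
  qed
qed

text \<open>A discretised curve from 0. Only its vertices have to lie in \<open>K\<close>; the short
  steps between them are absorbed by the width \<open>2 * \<epsilon> * t\<close> of the fast
  region.\<close>

definition polygon_in :: "(real ^ 'd::finite) set \<Rightarrow> real \<Rightarrow> nat \<Rightarrow> (nat \<Rightarrow> real ^ 'd) \<Rightarrow> bool" where
  "polygon_in K \<epsilon> m p \<longleftrightarrow> p 0 = 0 \<and> (\<forall>i\<le>m. p i \<in> K) \<and> (\<forall>i<m. l1_norm (p (Suc i) - p i) \<le> \<epsilon>)"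

text \<open>Round the vertices of \<open>t p\<close> to the lattice and join them by geodesics,
  which stay within \<open>2 * \<epsilon> * t\<close> of \<open>t K\<close>. An edge there is fast,
  or in the ball of radius \<open>M\<close>, or so close to the origin that a direct geodesic
  reaches it in time \<open>c * M + \<sigma> * (\<rho> * t + 1)\<close>. Rounding lengthens each of
  the \<open>m\<close> steps by at most the dimension.\<close>

lemma polygon_end_in_fpp_ball:
  fixes K :: "(real ^ 'd::finite) set"
  assumes K: "bounded K"
    and pos: "0 < \<epsilon>" "0 \<le> \<rho>" "0 \<le> \<eta>" "\<eta> \<le> \<sigma>" "0 \<le> M" "0 \<le> c" "0 < t"
    and t: "2 * real CARD('d) \<le> \<epsilon> * t"
  obtains L where
    "\<forall>n\<ge>L. \<forall>\<omega>. (\<forall>e\<in>lattice_edges. 0 \<le> \<omega> e) \<longrightarrow> (\<forall>e\<in>ball_edges M. \<omega> e \<le> c) \<longrightarrow>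
       (\<forall>e \<in> ball_edges n - ball_edges M.
         \<omega> e \<le> (if e \<in> fast_edges ((*\<^sub>R) t ` K) (\<rho> * t) (2 * \<epsilon> * t) then \<eta> else \<sigma>)) \<longrightarrow>
       (\<forall>m p. polygon_in K \<epsilon> m p \<longrightarrow> c * of_int M + \<sigma> * (\<rho> * t + 1) +
         \<eta> * (t * (\<Sum>i<m. l1_norm (p (Suc i) - p i)) + real CARD('d) * real m) \<le> t \<longrightarrow>
         t *\<^sub>R p m \<in> fpp_ball \<omega> t)"
proof -
  define W :: "(int ^ 'd) set" where "W = {w. infdist (real_vec w) ((*\<^sub>R) t ` K) \<le> 2 * \<epsilon> * t}"
  obtain b where b: "\<And>y. y \<in> K \<Longrightarrow> norm y \<le> b" using K by (auto simp: bounded_iff)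
  \<comment> \<open>Every vertex of \<open>W\<close> has l1 norm at most \<open>L\<close>, so edges
    inside \<open>W\<close> belong to the constrained box.\<close>
  define L where "L = \<lceil>real CARD('d) * (t * b + 2 * \<epsilon> * t)\<rceil>"
  show thesis
  proof (rule that[of L], intro allI impI)
    fix n \<omega> m and p :: "nat \<Rightarrow> real ^ 'd"
    assume n: "L \<le> n" and nonneg: "\<forall>e\<in>lattice_edges. 0 \<le> \<omega> e"
      and inner: "\<forall>e\<in>ball_edges M. \<omega> e \<le> c"
      and outer: "\<forall>e \<in> ball_edges n - ball_edges M.
         \<omega> e \<le> (if e \<in> fast_edges ((*\<^sub>R) t ` K) (\<rho> * t) (2 * \<epsilon> * t) then \<eta> else \<sigma>)"
      and p: "polygon_in K \<epsilon> m p"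
      and time: "c * of_int M + \<sigma> * (\<rho> * t + 1) +
         \<eta> * (t * (\<Sum>i<m. l1_norm (p (Suc i) - p i)) + real CARD('d) * real m) \<le> t"
    have "0 \<in> K" using p by (auto simp: polygon_in_def)
    then have ne: "(*\<^sub>R) t ` K \<noteq> {}" by auto
    \<comment> \<open>Time in which vertices of norm up to \<open>\<rho> * t + 1\<close> in the box
      are reached directly. The extra 1 is needed because a non-fast edge inside \<open>W\<close> is
      only known to have one endpoint of norm below \<open>\<rho> * t\<close>.\<close>
    define C where "C = c * of_int M + \<sigma> * (\<rho> * t + 1)"
    have CM: "c * of_int M \<le> C" "0 \<le> C" using pos by (auto simp: C_def)
    have W_le: "lnorm w \<le> n" if "w \<in> W" for w
    proof -
      have "norm (real_vec w) - t * b \<le> infdist (real_vec w) ((*\<^sub>R) t ` K)"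
        unfolding infdist_notempty[OF ne]
      proof (rule cINF_greatest[OF ne])
        fix z assume "z \<in> (*\<^sub>R) t ` K"
        then obtain y where y: "z = t *\<^sub>R y" "y \<in> K" by auto
        have "norm z \<le> t * b" using y b[of y] pos by simp
        then show "norm (real_vec w) - t * b \<le> dist (real_vec w) z"
          using norm_triangle_ineq2[of "real_vec w" z] by (simp add: dist_norm)
      qed
      then have "norm (real_vec w) \<le> t * b + 2 * \<epsilon> * t" using that by (simp add: W_def)
      then have "of_int (lnorm w) \<le> real CARD('d) * (t * b + 2 * \<epsilon> * t)"
        using order_trans[OF l1_norm_le_norm[of "real_vec w"] mult_left_mono[of "norm (real_vec w)" "t * b + 2 * \<epsilon> * t" "real CARD('d)"]]
        by (simp only: l1_norm_real_vec of_nat_0_le_iff)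
      then show ?thesis using n unfolding L_def by linarith
    qed
    have outer': "\<omega> e \<le> \<sigma>" if "e \<in> ball_edges n" "e \<notin> ball_edges M" for e
      using bspec[OF outer, of e] that pos by (auto split: if_splits)
    have ball_n: "vertex_time \<omega> v \<le> c * of_int M + \<sigma> * of_int (lnorm v)" if "lnorm v \<le> n" for v
      by (rule vertex_time_ball_le(1)[where n = n]) (use nonneg inner outer' pos that in auto)
    have ball_M: "vertex_time \<omega> v \<le> c * of_int M" if "lnorm v \<le> M" for v
      by (rule vertex_time_ball_le(2)[where n = n and \<sigma> = \<sigma>]) (use nonneg inner outer' pos that in auto)
    have step: "vertex_time \<omega> v \<le> max C (vertex_time \<omega> u + \<eta>)"
      if uv: "lnorm (u - v) = 1" "u \<in> W" "v \<in> W" for u v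
    proof -
      have e: "{u, v} \<in> ball_edges n" using uv W_le by (auto simp: ball_edges_def edge_iff)
      consider "{u, v} \<in> ball_edges M"
        | "{u, v} \<notin> ball_edges M" "{u, v} \<in> fast_edges ((*\<^sub>R) t ` K) (\<rho> * t) (2 * \<epsilon> * t)"
        | "{u, v} \<notin> fast_edges ((*\<^sub>R) t ` K) (\<rho> * t) (2 * \<epsilon> * t)" by blast
      then show ?thesis
      proof cases
        case 1
        then have "lnorm v \<le> M" by (simp add: ball_edges_def)
        from ball_M[OF this] show ?thesis using CM by simp
      next
        case 2
        then have "\<omega> {u, v} \<le> \<eta>" using bspec[OF outer, of "{u, v}"] e by simp
        then show ?thesis using vertex_time_step[of \<omega> u v] nonneg uv by fastforce
      next
        case 3
        then have "of_int (lnorm u) < \<rho> * t \<or> of_int (lnorm v) < \<rho> * t"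
          using uv by (auto simp: fast_edges_def edge_iff W_def)
        moreover have "lnorm v \<le> lnorm u + 1" using lnorm_diff_le[of u v] uv by simp
        then have "of_int (lnorm v) \<le> of_int (lnorm u) + (1::real)"
          by (metis of_int_le_iff of_int_add of_int_1)
        ultimately have "of_int (lnorm v) \<le> \<rho> * t + 1" by linarith
        then have "\<sigma> * of_int (lnorm v) \<le> \<sigma> * (\<rho> * t + 1)" using pos by (intro mult_left_mono) auto
        then show ?thesis using ball_n[OF W_le[OF uv(3)]] unfolding C_def by simp
      qed
    qed
    define q where "q i = lattice_point (t *\<^sub>R p i)" for i
    have q_step: "of_int (lnorm (q (Suc i) - q i)) \<le> t * l1_norm (p (Suc i) - p i) + real CARD('d)" for i
    proof -
      have "t *\<^sub>R p (Suc i) - t *\<^sub>R p i = t *\<^sub>R (p (Suc i) - p i)" by (simp add: algebra_simps)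
      then show ?thesis
        using lnorm_lattice_point_diff[of "t *\<^sub>R p (Suc i)" "t *\<^sub>R p i"] pos
        by (simp add: q_def l1_norm_scaleR)
    qed
    have q0: "vertex_time \<omega> (q 0) \<le> C"
      using p vertex_time_zero[of \<omega>] nonneg CM by (simp add: q_def polygon_in_def)
    have near: "w \<in> W" if "i < m" "lnorm (w - q i) \<le> lnorm (q (Suc i) - q i)" for i w
    proof -
      have "t * l1_norm (p (Suc i) - p i) \<le> \<epsilon> * t"
        using p that pos by (subst mult.commute, intro mult_right_mono) (auto simp: polygon_in_def)
      moreover have "real_of_int (lnorm (w - q i)) \<le> of_int (lnorm (q (Suc i) - q i))" using that by simp
      ultimately have "dist (real_vec w) (real_vec (q i)) \<le> \<epsilon> * t + real CARD('d)"
        using dist_real_vec_le[of w "q i"] q_step[of i] by linarith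
      then have "dist (real_vec w) (t *\<^sub>R p i) \<le> 2 * \<epsilon> * t"
        using dist_triangle[of "real_vec w" "t *\<^sub>R p i" "real_vec (q i)"]
          dist_lattice_point[of "t *\<^sub>R p i"] t unfolding q_def by linarith
      moreover have "t *\<^sub>R p i \<in> (*\<^sub>R) t ` K" using p that by (auto simp: polygon_in_def)
      ultimately show ?thesis unfolding W_def by (auto intro: infdist_le2)
    qed
    have "vertex_time \<omega> (q m) \<le> C + \<eta> * (\<Sum>i<m. of_int (lnorm (q (Suc i) - q i)))"
      by (rule vertex_time_polygon_le[where W = W and q = q and m = m, OF step \<open>0 \<le> \<eta>\<close> q0 near])
    also have "(\<Sum>i<m. of_int (lnorm (q (Suc i) - q i))) \<le>
        (\<Sum>i<m. t * l1_norm (p (Suc i) - p i) + real CARD('d))"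
      using q_step by (intro sum_mono)
    also have "\<dots> = t * (\<Sum>i<m. l1_norm (p (Suc i) - p i)) + real CARD('d) * real m"
      by (simp add: sum.distrib sum_distrib_left)
    finally have "vertex_time \<omega> (q m) \<le> t" using time pos(3) by (simp add: C_def mult_left_mono)
    then show "t *\<^sub>R p m \<in> fpp_ball \<omega> t" by (simp add: fpp_ball_eq q_def)
  qed
qed

subsection \<open>Hausdorff closeness\<close>

text \<open>Hausdorff closeness with attained witnesses, which composes by adding errors. It implies
  Hausdorff distance at most \<open>\<epsilon>\<close> and follows, for nonempty sets, from distance
  strictly below \<open>\<epsilon>\<close>.\<close>

definition hclose :: "real \<Rightarrow> 'a::metric_space set \<Rightarrow> 'a set \<Rightarrow> bool" where
  "hclose \<epsilon> S T \<longleftrightarrow> (\<forall>x\<in>S. \<exists>y\<in>T. dist x y \<le> \<epsilon>) \<and> (\<forall>y\<in>T. \<exists>x\<in>S. dist x y \<le> \<epsilon>)"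

lemma hclose_sym: "hclose \<epsilon> S T \<Longrightarrow> hclose \<epsilon> T S"
  by (simp add: hclose_def dist_commute)

lemma hclose_trans:
  assumes "hclose a S T" "hclose b T V"
  shows "hclose (a + b) S V"
  unfolding hclose_def
proof (intro conjI ballI)
  fix x assume "x \<in> S"
  then obtain y where y: "y \<in> T" "dist x y \<le> a" using assms(1) unfolding hclose_def by blast
  then obtain z where z: "z \<in> V" "dist y z \<le> b" using assms(2) unfolding hclose_def by blast
  then show "\<exists>z\<in>V. dist x z \<le> a + b" using y dist_triangle[of x z y] by (intro bexI[of _ z]) auto
next
  fix z assume "z \<in> V"
  then obtain y where y: "y \<in> T" "dist y z \<le> b" using assms(2) unfolding hclose_def by blast
  then obtain x where x: "x \<in> S" "dist x y \<le> a" using assms(1) unfolding hclose_def by blast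
  then show "\<exists>x\<in>S. dist x z \<le> a + b" using y dist_triangle[of x z y] by (intro bexI[of _ x]) auto
qed

lemma hausdorff_dist_le_if_hclose:
  assumes "hclose \<epsilon> S T"
  shows "hausdorff_dist S T \<le> ereal \<epsilon>"
proof -
  have "infdist x T \<le> \<epsilon>" if "x \<in> S" for x
    using assms that unfolding hclose_def by (blast intro: infdist_le2)
  moreover have "infdist y S \<le> \<epsilon>" if "y \<in> T" for y
    using hclose_sym[OF assms] that unfolding hclose_def by (blast intro: infdist_le2)
  ultimately show ?thesis unfolding hausdorff_dist_def by (auto intro!: SUP_least)
qed

lemma hclose_if_hausdorff_dist_less:
  assumes "hausdorff_dist S T < ereal \<epsilon>" "S \<noteq> {}" "T \<noteq> {}"
  shows "hclose \<epsilon> S T"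
proof -
  have near: "\<exists>y\<in>B. dist x y \<le> \<epsilon>" if x: "infdist x B < \<epsilon>" and B: "B \<noteq> {}" for x :: 'a and B
  proof -
    have "bdd_below (dist x ` B)" by (rule bdd_belowI2[of _ 0]) simp
    moreover have "(INF y\<in>B. dist x y) < \<epsilon>" using x B by (simp add: infdist_notempty)
    ultimately obtain y where "y \<in> B" "dist x y < \<epsilon>"
      using cINF_less_iff[OF B] by blast
    then show ?thesis by (intro bexI[of _ y]) auto
  qed
  have "infdist x T < \<epsilon>" if "x \<in> S" for x
  proof -
    have "ereal (infdist x T) \<le> hausdorff_dist S T"
      unfolding hausdorff_dist_def using that by (intro max.coboundedI1 SUP_upper)
    from order_le_less_trans[OF this assms(1)] show ?thesis by simp
  qed
  moreover have "infdist y S < \<epsilon>" if "y \<in> T" for y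
  proof -
    have "ereal (infdist y S) \<le> hausdorff_dist S T"
      unfolding hausdorff_dist_def using that by (intro max.coboundedI2 SUP_upper)
    from order_le_less_trans[OF this assms(1)] show ?thesis by simp
  qed
  ultimately show ?thesis
    unfolding hclose_def using near[OF _ assms(2)] near[OF _ assms(3)] by (simp add: dist_commute)
qed

lemma hausdorff_dist_nonneg:
  assumes "T \<noteq> {}"
  shows "0 \<le> hausdorff_dist S T"
proof -
  obtain y where "y \<in> T" using assms by auto
  have "0 \<le> ereal (infdist y S)" by (simp add: infdist_nonneg)
  also have "\<dots> \<le> hausdorff_dist S T"
    unfolding hausdorff_dist_def using \<open>y \<in> T\<close> by (intro max.coboundedI2 SUP_upper)
  finally show ?thesis .
qed

section \<open>From curves to polygons with controlled length\<close>

lemma polygon_from_path: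
  fixes g :: "real \<Rightarrow> real ^ 'd::finite"
  assumes g: "path g" "path_image g \<subseteq> K" "pathstart g = 0" "pathfinish g = x"
    and len: "l1_length g \<le> b" and "0 < \<epsilon>"
  obtains m p where "polygon_in K \<epsilon> m p" "p m = x" "ereal (\<Sum>i<m. l1_norm (p (Suc i) - p i)) \<le> b"
proof -
  have "uniformly_continuous_on {0..1} g"
    using g(1) by (auto simp: path_def intro: compact_uniformly_continuous)
  then obtain \<delta> where \<delta>: "0 < \<delta>" "\<And>u v. \<lbrakk>u \<in> {0..1}; v \<in> {0..1}; dist v u < \<delta>\<rbrakk> \<Longrightarrow>
      dist (g v) (g u) < \<epsilon> / real CARD('d)"
    using \<open>0 < \<epsilon>\<close> unfolding uniformly_continuous_on_def
    by (metis divide_pos_pos of_nat_0_less_iff zero_less_card_finite)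
  obtain n where n: "inverse (real (Suc n)) < \<delta>" using reals_Archimedean[OF \<delta>(1)] by blast
  define m where "m = Suc n"
  define p where "p i = g (real i / real m)" for i
  have m: "0 < m" "1 / real m < \<delta>" using n by (auto simp: m_def inverse_eq_divide)
  have in01: "real i / real m \<in> {0..1}" if "i \<le> m" for i using that m by simp
  have "l1_norm (p (Suc i) - p i) \<le> \<epsilon>" if "i < m" for i
  proof -
    have "real (Suc i) / real m - real i / real m = 1 / real m" by (simp flip: diff_divide_distrib)
    then have "dist (real (Suc i) / real m) (real i / real m) < \<delta>" using m by (simp add: dist_real_def)
    then have "dist (p (Suc i)) (p i) < \<epsilon> / real CARD('d)"
      unfolding p_def using that by (intro \<delta>(2) in01) auto
    then have "real CARD('d) * norm (p (Suc i) - p i) \<le> \<epsilon>"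
      by (simp add: dist_norm field_simps)
    then show ?thesis using l1_norm_le_norm order_trans by blast
  qed
  then have "polygon_in K \<epsilon> m p"
    using g in01 by (auto simp: polygon_in_def p_def pathstart_def path_image_def)
  moreover have "p m = x" using g m by (simp add: p_def pathfinish_def)
  moreover have "ereal (\<Sum>i<m. l1_norm (p (Suc i) - p i)) \<le> b"
  proof -
    \<comment> \<open>The equidistant subdivision, made fine by uniform continuity, is itself one of
      the partitions in the supremum \<open>l1_length g\<close>, so the polygon is no longer than
      the curve.\<close>
    define ts where "ts = map (\<lambda>i. real i / real m) [0..<Suc m]"
    have nth: "ts ! i = real i / real m" if "i \<le> m" for i
      using that unfolding ts_def by (subst nth_map) (auto simp del: upt_Suc)
    have "sorted ts" unfolding ts_def sorted_map
      by (rule sorted_wrt_mono_rel[of _ "(\<le>)"]) (auto intro: divide_right_mono simp del: upt_Suc)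
    moreover have "set ts \<subseteq> {0..1}" using in01 by (auto simp: ts_def simp del: upt_Suc)
    ultimately have "ereal (\<Sum>i<length ts - 1. l1_norm (g (ts ! Suc i) - g (ts ! i))) \<le> l1_length g"
      unfolding l1_length_def by (intro SUP_upper) auto
    also have "(\<Sum>i<length ts - 1. l1_norm (g (ts ! Suc i) - g (ts ! i))) = (\<Sum>i<m. l1_norm (p (Suc i) - p i))"
      by (rule sum.cong) (auto simp: nth p_def ts_def[THEN arg_cong[where f = length]] simp del: upt_Suc)
    finally show ?thesis using len by (rule order_trans)
  qed
  ultimately show thesis by (rule that)
qed

text \<open>This is where the gap \<open>\<alpha>\<close> enters. If \<open>a * l\<close> were at
  least 1 throughout \<open>A\<close>, then inf A would be at least \<open>1 / l\<close>, so
  \<open>1 / inf A\<close> would be finite and at most \<open>l\<close>, contradicting the bound on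
  \<open>l\<close>.\<close>

lemma exists_element_below:
  assumes A: "A \<subseteq> {0..}" "A \<noteq> {}" and "0 < \<alpha>"
    and l: "ereal l \<le> 1 / (INF a\<in>A. ereal a) - ereal \<alpha>"
  shows "\<exists>\<eta>\<in>A. \<eta> * l < 1"
proof (rule ccontr)
  assume "\<not> ?thesis"
  then have ge: "1 \<le> a * l" if "a \<in> A" for a using that by force
  obtain a where a: "a \<in> A" using A by auto
  then have "0 < a * l" "0 \<le> a" using ge[OF a] A by auto
  then have lpos: "0 < l" by (simp add: zero_less_mult_iff)
  have "ereal (1 / l) \<le> (INF a\<in>A. ereal a)"
    using ge lpos by (intro INF_greatest) (auto simp: field_simps)
  moreover have "(INF a\<in>A. ereal a) \<le> ereal a" using a by (rule INF_lower)
  ultimately obtain r where r: "(INF a\<in>A. ereal a) = ereal r" "1 / l \<le> r"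
    by (cases "INF a\<in>A. ereal a") auto
  have "0 < r" using r lpos by (smt (verit) divide_pos_pos)
  then have "1 / (INF a\<in>A. ereal a) = ereal (1 / r)" by (simp add: r one_ereal_def)
  then have "l \<le> 1 / r - \<alpha>" using l by simp
  moreover have "1 / r \<le> l" using r \<open>0 < r\<close> lpos by (simp add: field_simps)
  ultimately show False using \<open>0 < \<alpha>\<close> by linarith
qed

section \<open>Numerical choice of the fast and slow values\<close>

lemma exists_larger_mult_less_1:
  fixes a k :: real
  assumes "a * k < 1" "0 \<le> k"
  obtains b where "a < b" "b * k < 1"
proof -
  \<comment> \<open>Dividing by \<open>k + 1\<close> instead of \<open>k\<close> includes the case
    \<open>k = 0\<close>.\<close>
  define h where "h = (1 - a * k) / 2 / (k + 1)"
  have "0 < h" using assms by (simp add: h_def)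
  then have "h * k \<le> h * (k + 1)" by simp
  also have "\<dots> = (1 - a * k) / 2"
    unfolding h_def using assms by (metis add_nonneg_pos less_irrefl nonzero_eq_divide_eq zero_less_one)
  finally have "(a + h) * k < 1" using assms by (simp add: distrib_right)
  then show thesis using \<open>0 < h\<close> by (intro that[of "a + h"]) auto
qed

text \<open>The values \<open>\<eta>\<close> and \<open>\<sigma>\<close> must lie in
  \<open>A\<close>, but the estimates have to hold on an open set of configurations. Hence the
  strict margins \<open>\<eta>2\<close>, \<open>\<sigma>1\<close>, \<open>\<sigma>2\<close>: upper
  margins enter the travel-time budget, the lower margin \<open>\<sigma>1\<close> enters
  confinement.\<close>

lemma exists_parameters:
  fixes A :: "real set"
  assumes A: "A \<subseteq> {0..}" "\<exists>a\<in>A. \<exists>b\<in>A. a \<noteq> b"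
    and ext: "(INF a\<in>A. ereal a) = 0 \<or> (SUP a\<in>A. ereal a) = \<infinity>"
    and l: "\<eta>' \<in> A" "\<eta>' * l < 1" "0 \<le> l" and "0 < \<epsilon>"
  obtains \<eta> \<eta>2 \<sigma>1 \<sigma> \<sigma>2 \<rho> r where
    "\<eta> \<in> A" "\<sigma> \<in> A" "\<eta> < \<eta>2" "\<eta>2 \<le> \<sigma>2" "0 < \<sigma>1" "\<sigma>1 < \<sigma>" "\<sigma> < \<sigma>2" "0 \<le> \<rho>"
    "\<sigma>2 * \<rho> + \<eta>2 * l < 1" "1 / \<sigma>1 - \<rho> \<le> \<epsilon>" "1 / \<sigma>1 \<le> r + \<epsilon>" "0 \<le> r"
    "ereal r \<le> 1 / (SUP a\<in>A. ereal a)"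
proof (cases "(SUP a\<in>A. ereal a) = \<infinity>")
  case True
  obtain \<eta>2 where \<eta>2: "\<eta>' < \<eta>2" "\<eta>2 * l < 1" using exists_larger_mult_less_1[OF l(2,3)] .
  \<comment> \<open>The 1 leaves room for \<open>\<sigma>1 = \<sigma> - 1\<close> with
    \<open>1 / \<sigma>1 \<le> \<epsilon>\<close>; the term \<open>\<bar>\<eta>2\<bar>\<close>
    ensures \<open>\<eta>2 \<le> \<sigma>2\<close>.\<close>
  have "ereal (1 / \<epsilon> + 1 + \<bar>\<eta>2\<bar>) < (SUP a\<in>A. ereal a)" using True by simp
  then obtain \<sigma> where \<sigma>: "\<sigma> \<in> A" "1 / \<epsilon> + 1 + \<bar>\<eta>2\<bar> < \<sigma>" by (auto simp: less_SUP_iff)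
  have "0 < 1 / \<epsilon>" using \<open>0 < \<epsilon>\<close> by simp
  then have \<sigma>1: "0 < \<sigma> - 1" "1 / \<epsilon> \<le> \<sigma> - 1" "\<eta>2 \<le> \<sigma> + 1" using \<sigma> by linarith+
  then have "1 / (\<sigma> - 1) \<le> \<epsilon>" using \<open>0 < \<epsilon>\<close> by (simp add: field_simps)
  then show thesis using \<sigma>(1) \<sigma>1 \<eta>2 l True
    by (intro that[of \<eta>' \<sigma> \<eta>2 "\<sigma> + 1" "\<sigma> - 1" 0 0]) simp_all
next
  case False
  then have inf0: "(INF a\<in>A. ereal a) = 0" using ext by simp
  obtain a where a: "a \<in> A" "0 < a" using A by (metis atLeast_iff less_eq_real_def subsetD)
  have "ereal a \<le> (SUP a\<in>A. ereal a)" using a(1) by (rule SUP_upper)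
  then obtain s where s: "(SUP a\<in>A. ereal a) = ereal s" "a \<le> s" using False
    by (cases "SUP a\<in>A. ereal a") auto
  have "0 < s" using s a by linarith
  define \<kappa> where "\<kappa> = \<epsilon> / 3"
  \<comment> \<open>A number below \<open>s\<close> whose reciprocal exceeds \<open>1 / s\<close> by
    exactly \<open>\<kappa>\<close>; taking \<open>\<sigma>1\<close> above it keeps
    \<open>1 / \<sigma>1\<close> within \<open>\<kappa>\<close> of \<open>1 / s\<close>.\<close>
  define b where "b = 1 / (1 / s + \<kappa>)"
  have \<kappa>: "0 < \<kappa>" using \<open>0 < \<epsilon>\<close> by (simp add: \<kappa>_def)
  have b: "0 < b" "1 / b = 1 / s + \<kappa>" using \<open>0 < s\<close> \<kappa> by (auto simp: b_def add_pos_pos)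
  have "1 / s < 1 / b" using b(2) \<kappa> by simp
  then have "b < s" using \<open>0 < s\<close> b(1) by (simp add: field_simps)
  then have "ereal b < (SUP a\<in>A. ereal a)" using s by simp
  then obtain \<sigma> where \<sigma>: "\<sigma> \<in> A" "b < \<sigma>" by (auto simp: less_SUP_iff)
  have "ereal \<sigma> \<le> (SUP a\<in>A. ereal a)" using \<sigma>(1) by (rule SUP_upper)
  then have "\<sigma> \<le> s" using s by simp
  define \<sigma>1 where "\<sigma>1 = (b + \<sigma>) / 2"
  have \<sigma>1: "b < \<sigma>1" "\<sigma>1 < \<sigma>" using \<sigma> by (auto simp: \<sigma>1_def)
  have i\<sigma>1: "1 / \<sigma>1 \<le> 1 / s + \<kappa>"
    unfolding b(2)[symmetric] using b(1) \<sigma>1 by (intro divide_left_mono) auto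
  \<comment> \<open>With \<open>1 / \<sigma>1 \<le> 1 / s + \<kappa>\<close> this gives
    \<open>1 / \<sigma>1 - \<rho> \<le> 2 * \<kappa>\<close>, within \<open>\<epsilon>\<close>,
    while \<open>\<rho> < 1 / s\<close> keeps \<open>\<sigma> * \<rho>\<close> below 1. The maximum
    handles \<open>1 / s < \<kappa>\<close>.\<close>
  define \<rho> where "\<rho> = max 0 (1 / s - \<kappa>)"
  have "\<rho> < 1 / s" using \<open>0 < s\<close> \<kappa> by (simp add: \<rho>_def)
  then have "\<rho> * s < 1" using \<open>0 < s\<close> by (simp add: field_simps)
  moreover have "\<sigma> * \<rho> \<le> s * \<rho>" using \<open>\<sigma> \<le> s\<close> by (intro mult_right_mono) (auto simp: \<rho>_def)
  ultimately have "\<sigma> * \<rho> < 1" by (simp add: mult.commute)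
  then obtain \<sigma>2 where \<sigma>2: "\<sigma> < \<sigma>2" "\<sigma>2 * \<rho> < 1"
    using exists_larger_mult_less_1[of \<sigma> \<rho>] by (auto simp: \<rho>_def)
  \<comment> \<open>The curve may use half of the budget that the slow start leaves over; inf A = 0
    then provides \<open>\<eta>\<close> below \<open>\<eta>2\<close>.\<close>
  define \<eta>2 where "\<eta>2 = min \<sigma>2 ((1 - \<sigma>2 * \<rho>) / 2 / (l + 1))"
  have "0 < \<eta>2" using \<sigma>2 \<sigma> b l by (auto simp: \<eta>2_def)
  then have "(INF a\<in>A. ereal a) < ereal \<eta>2" using inf0 by simp
  then obtain \<eta> where \<eta>: "\<eta> \<in> A" "\<eta> < \<eta>2" by (auto simp: INF_less_iff)
  have "\<eta>2 * l \<le> \<eta>2 * (l + 1)" using \<open>0 < \<eta>2\<close> by simp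
  also have "\<dots> \<le> (1 - \<sigma>2 * \<rho>) / 2 / (l + 1) * (l + 1)"
    using l by (intro mult_right_mono) (auto simp: \<eta>2_def)
  also have "\<dots> = (1 - \<sigma>2 * \<rho>) / 2"
    using l(3) by (metis add_nonneg_pos less_irrefl nonzero_eq_divide_eq zero_less_one)
  finally have "\<sigma>2 * \<rho> + \<eta>2 * l < 1" using \<sigma>2(2) by (simp add: field_simps)
  moreover have "ereal (1 / s) \<le> 1 / (SUP a\<in>A. ereal a)" using s \<open>0 < s\<close> by (simp add: one_ereal_def)
  moreover have "1 / \<sigma>1 - \<rho> \<le> \<epsilon>" "1 / \<sigma>1 \<le> 1 / s + \<epsilon>"
    using i\<sigma>1 \<kappa> unfolding \<rho>_def \<kappa>_def by linarith+
  ultimately show thesis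
    using \<eta> \<sigma> \<sigma>1 \<sigma>2 b \<open>0 < s\<close> by (intro that[of \<eta> \<sigma> \<eta>2 \<sigma>2 \<sigma>1 \<rho> "1 / s"]) (auto simp: \<rho>_def \<eta>2_def)
qed

text \<open>The hypothesis says that the interior of each \<open>G i\<close> is dense, so its
  complement is closed with empty interior. Only \<open>V \<inter> U \<noteq> {}\<close> is asked
  for, so \<open>V\<close> may extend beyond \<open>U\<close>.\<close>

lemma residual_if_dense_open_cores:
  assumes "countable I"
    and dense: "\<And>i U. \<lbrakk>i \<in> I; openin X U; U \<noteq> {}\<rbrakk> \<Longrightarrow> \<exists>V. openin X V \<and> V \<inter> U \<noteq> {} \<and> V \<subseteq> G i"
  obtains R where "residual_in X R" "\<And>i. i \<in> I \<Longrightarrow> R \<subseteq> G i"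
proof -
  define N where "N i = topspace X - X interior_of G i" for i
  define R where "R = topspace X - (\<Union>i\<in>I. N i)"
  have "nowhere_dense_in X (N i)" if i: "i \<in> I" for i
  proof -
    have "X interior_of N i = {}"
    proof (rule ccontr)
      assume "X interior_of N i \<noteq> {}"
      then obtain V where V: "openin X V" "V \<inter> X interior_of N i \<noteq> {}" "V \<subseteq> G i"
        using dense[OF i openin_interior_of] by blast
      then have "V \<subseteq> X interior_of G i" by (simp add: interior_of_maximal)
      then show False using V(2) interior_of_subset[of X "N i"] by (auto simp: N_def)
    qed
    moreover have "closedin X (N i)" unfolding N_def by (simp add: closedin_diff)
    ultimately show ?thesis
      by (simp add: nowhere_dense_in_def closure_of_closedin) (simp add: N_def)
  qed
  moreover have "topspace X - R = \<Union> (N ` I)" by (auto simp: R_def N_def)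
  ultimately have "meager_in X (topspace X - R)"
    unfolding meager_in_def using \<open>countable I\<close> by (intro exI[of _ "N ` I"]) auto
  then have "residual_in X R" by (auto simp: residual_in_def R_def)
  moreover have "R \<subseteq> G i" if "i \<in> I" for i
    using that interior_of_subset[of X "G i"] by (auto simp: R_def N_def)
  ultimately show thesis by (rule that)
qed

subsection \<open>Genericity\<close>

lemma eventually_affine_le:
  fixes a k :: real
  assumes "k < 1"
  shows "eventually (\<lambda>t. a + k * t \<le> t) at_top"
  using eventually_ge_at_top[of "a / (1 - k)"]
  by eventually_elim (use assms in \<open>simp add: field_simps\<close>)

lemma eventually_le_mult_right:
  fixes a \<epsilon> :: real
  assumes "0 < \<epsilon>"
  shows "eventually (\<lambda>t. a \<le> \<epsilon> * t) at_top"
  using eventually_ge_at_top[of "a / \<epsilon>"]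
  by eventually_elim (use assms in \<open>simp add: field_simps\<close>)

lemma zero_in_K_sets:
  assumes "A \<subseteq> {0..}" "A \<noteq> {}" "K \<in> K_sets A"
  shows "0 \<in> K"
proof -
  obtain a where "a \<in> A" using assms(2) by auto
  then have "0 \<le> (SUP a\<in>A. ereal a)" using assms(1) by (intro SUP_upper2[of a]) auto
  then have "0 \<le> 1 / (SUP a\<in>A. ereal a)" by simp
  then show ?thesis
    using assms(3) by (auto simp: K_sets_def l1_ball_def l1_norm_def zero_ereal_def subset_iff)
qed

text \<open>The largest of finitely many polygon lengths is attained and inherits the bound with gap
  \<open>\<alpha>\<close>, so a single \<open>\<eta>\<close> serves all target points.\<close>

lemma P_sets_polygons:
  assumes A: "A \<subseteq> {0..}" "A \<noteq> {}" and K: "K \<in> P_sets A" and "0 < \<epsilon>" and X: "finite X" "X \<subseteq> K" "X \<noteq> {}"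
  obtains \<eta> l m p where "\<eta> \<in> A" "\<eta> * l < 1" "0 \<le> l"
    "\<forall>x\<in>X. polygon_in K \<epsilon> (m x) (p x) \<and> p x (m x) = x \<and>
      (\<Sum>i<m x. l1_norm (p x (Suc i) - p x i)) \<le> l"
proof -
  obtain \<alpha> where \<alpha>: "0 < \<alpha>" "\<And>x. x \<in> K \<Longrightarrow> \<exists>g. path g \<and> path_image g \<subseteq> K \<and> pathstart g = 0 \<and>
      pathfinish g = x \<and> l1_length g \<le> 1 / (INF a\<in>A. ereal a) - ereal \<alpha>"
    using K unfolding P_sets_def by blast
  have "\<exists>m p. polygon_in K \<epsilon> m p \<and> p m = x \<and>
      ereal (\<Sum>i<m. l1_norm (p (Suc i) - p i)) \<le> 1 / (INF a\<in>A. ereal a) - ereal \<alpha>" if "x \<in> X" for x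
  proof -
    have "x \<in> K" using that X by auto
    from \<alpha>(2)[OF this] obtain g where "path g" "path_image g \<subseteq> K" "pathstart g = 0" "pathfinish g = x"
      "l1_length g \<le> 1 / (INF a\<in>A. ereal a) - ereal \<alpha>" by blast
    from polygon_from_path[OF this \<open>0 < \<epsilon>\<close>] show ?thesis by blast
  qed
  then obtain m p where mp: "\<And>x. x \<in> X \<Longrightarrow> polygon_in K \<epsilon> (m x) (p x) \<and> p x (m x) = x \<and>
      ereal (\<Sum>i<m x. l1_norm (p x (Suc i) - p x i)) \<le> 1 / (INF a\<in>A. ereal a) - ereal \<alpha>"
    by metis
  define len where "len x = (\<Sum>i<m x. l1_norm (p x (Suc i) - p x i))" for x
  define l where "l = Max (len ` X)"
  have "l \<in> len ` X" unfolding l_def using X by (intro Max_in) auto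
  then have l: "ereal l \<le> 1 / (INF a\<in>A. ereal a) - ereal \<alpha>" "0 \<le> l"
    using mp by (auto simp: len_def sum_nonneg l1_norm_nonneg)
  obtain \<eta> where "\<eta> \<in> A" "\<eta> * l < 1" using exists_element_below[OF A \<alpha>(1) l(1)] by blast
  moreover have "len x \<le> l" if "x \<in> X" for x using that X by (simp add: l_def)
  ultimately show thesis using mp l(2) by (intro that[of \<eta> l m p]) (auto simp: len_def)
qed

text \<open>Of the configuration \<open>\<omega>0\<close> near the origin, \<open>V\<close> retains
  only an upper bound \<open>c\<close> on passage times. That suffices because the inner ball costs
  at most \<open>c * M\<close> to cross and gains a path at most distance \<open>M\<close>, both
  negligible against \<open>t\<close>.\<close>

lemma fpp_ball_close_on_dense_open:
  fixes K :: "(real ^ 'd::finite) set" and U :: "((int ^ 'd) set \<Rightarrow> real) set"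
  assumes A: "A \<subseteq> {0..}" "\<exists>a\<in>A. \<exists>b\<in>A. a \<noteq> b"
    and ext: "(INF a\<in>A. ereal a) = 0 \<or> (SUP a\<in>A. ereal a) = \<infinity>"
    and K: "K \<in> P_sets A" and "0 < \<epsilon>"
    and U: "openin (config_space A) U" "U \<noteq> {}"
  obtains V where "openin (config_space A) V" "V \<inter> U \<noteq> {}"
    "\<And>\<omega>. \<omega> \<in> V \<Longrightarrow> \<exists>t\<ge>N. 0 < t \<and> hclose \<epsilon> ((\<lambda>x. x /\<^sub>R t) ` fpp_ball \<omega> t) K"
proof -
  define \<delta> where "\<delta> = \<epsilon> / 6"
  have \<delta>: "0 < \<delta>" using \<open>0 < \<epsilon>\<close> by (simp add: \<delta>_def)
  have Kset: "compact K" "l1_ball (1 / (SUP a\<in>A. ereal a)) \<subseteq> K"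
    using K by (auto simp: P_sets_def K_sets_def)
  have inK: "x \<in> K" if "ereal r \<le> 1 / (SUP a\<in>A. ereal a)" "l1_norm x \<le> r" for x r
  proof -
    have "ereal (l1_norm x) \<le> 1 / (SUP a\<in>A. ereal a)" using that by (metis ereal_less_eq(3) order_trans)
    then show ?thesis using Kset(2) by (auto simp: l1_ball_def)
  qed
  have "A \<noteq> {}" using A by auto
  have K0: "0 \<in> K" using zero_in_K_sets[OF A(1) \<open>A \<noteq> {}\<close>, of K] K by (simp add: P_sets_def)
  obtain X where X: "finite X" "X \<subseteq> K" "K \<subseteq> (\<Union>x\<in>X. ball x \<delta>)"
    using compactE_image[OF Kset(1), of K "\<lambda>x. ball x \<delta>"] \<delta> by force
  then have "X \<noteq> {}" using K0 by auto
  obtain \<eta>' l m p where p: "\<eta>' \<in> A" "\<eta>' * l < 1" "0 \<le> l"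
    "\<forall>x\<in>X. polygon_in K \<delta> (m x) (p x) \<and> p x (m x) = x \<and>
      (\<Sum>i<m x. l1_norm (p x (Suc i) - p x i)) \<le> l"
    by (rule P_sets_polygons[OF A(1) \<open>A \<noteq> {}\<close> K \<delta> X(1,2) \<open>X \<noteq> {}\<close>])
  obtain \<eta> \<eta>2 \<sigma>1 \<sigma> \<sigma>2 \<rho> r where par:
    "\<eta> \<in> A" "\<sigma> \<in> A" "\<eta> < \<eta>2" "\<eta>2 \<le> \<sigma>2" "0 < \<sigma>1" "\<sigma>1 < \<sigma>" "\<sigma> < \<sigma>2" "0 \<le> \<rho>"
    "\<sigma>2 * \<rho> + \<eta>2 * l < 1" "1 / \<sigma>1 - \<rho> \<le> \<delta>" "1 / \<sigma>1 \<le> r + \<delta>" "0 \<le> r"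
    "ereal r \<le> 1 / (SUP a\<in>A. ereal a)"
    by (rule exists_parameters[OF A ext p(1-3) \<delta>])
  have \<eta>2: "0 \<le> \<eta>2" using par(1,3) A(1) by force
  obtain \<omega>0 where \<omega>0: "\<omega>0 \<in> U" using U by auto
  have top: "topspace (config_space A) = PiE lattice_edges (\<lambda>_. A)"
    by (simp add: config_space_def)
  have "U \<subseteq> topspace (config_space A)" using U openin_subset by blast
  then have \<omega>0A: "\<omega>0 \<in> PiE lattice_edges (\<lambda>_. A)" using \<omega>0 top by auto
  obtain W where W: "finite {e \<in> lattice_edges. W e \<noteq> topspace (top_of_set A)}"
    "\<omega>0 \<in> PiE lattice_edges W" "PiE lattice_edges W \<subseteq> U"
    using U(1) \<omega>0 unfolding config_space_def openin_product_topology_alt by blast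
  have finW: "finite {e \<in> lattice_edges. W e \<noteq> A}" using W(1) by simp
  obtain M where M: "0 \<le> M" "{e \<in> lattice_edges. W e \<noteq> A} \<subseteq> ball_edges M"
    using finite_edges_subset_ball[OF finW] by blast
  have "finite (\<omega>0 ` ball_edges M)" by (intro finite_imageI finite_ball_edges)
  then have "bdd_above (\<omega>0 ` ball_edges M)" by (rule bdd_above_finite)
  then obtain c0 where c0: "\<And>e. e \<in> ball_edges M \<Longrightarrow> \<omega>0 e \<le> c0"
    by (meson bdd_above.E imageI)
  \<comment> \<open>Adding 1 makes the bound strict, so that the open condition below
    \<open>c\<close> holds for \<open>\<omega>0\<close>.\<close>
  define c where "c = max 0 c0 + 1"
  have c: "0 \<le> c" by (simp add: c_def)
  have \<omega>0c: "\<omega>0 e < c" if "e \<in> ball_edges M" for e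
    using c0[OF that] by (simp add: c_def)
  \<comment> \<open>The time estimate is affine in \<open>t\<close> with slope
    \<open>\<sigma>2 * \<rho> + \<eta>2 * l < 1\<close>. Inner costs and rounding errors do not grow
    with \<open>t\<close>, since the polygons are fixed before \<open>t\<close>.\<close>
  have "eventually (\<lambda>t. \<forall>x\<in>X. (c * of_int M + \<sigma>2 + \<eta>2 * (real CARD('d) * real (m x))) + (\<sigma>2 * \<rho> + \<eta>2 * l) * t \<le> t) at_top"
    using X(1) par by (intro eventually_ball_finite ballI eventually_affine_le) auto
  then have "eventually (\<lambda>t. (\<forall>x\<in>X. (c * of_int M + \<sigma>2 + \<eta>2 * (real CARD('d) * real (m x))) + (\<sigma>2 * \<rho> + \<eta>2 * l) * t \<le> t) \<and>
      N \<le> t \<and> 0 < t \<and> of_int M \<le> \<delta> * t \<and> 2 * real CARD('d) \<le> \<delta> * t) at_top"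
    using \<delta> by (intro eventually_conj eventually_ge_at_top eventually_gt_at_top eventually_le_mult_right)
  from eventually_happens'[OF trivial_limit_at_top_linorder this]
  obtain t where t: "N \<le> t" "0 < t" "of_int M \<le> \<delta> * t" "2 * real CARD('d) \<le> \<delta> * t"
    "\<forall>x\<in>X. (c * of_int M + \<sigma>2 + \<eta>2 * (real CARD('d) * real (m x))) + (\<sigma>2 * \<rho> + \<eta>2 * l) * t \<le> t"
    by blast
  have t': "real CARD('d) \<le> \<delta> * t" using t(4) by linarith
  have bK: "bounded K" using Kset(1) by (rule compact_imp_bounded)
  define fast where "fast = fast_edges ((*\<^sub>R) t ` K) (\<rho> * t) (2 * \<delta> * t)"
  obtain L1 where L1: "\<forall>n\<ge>L1. \<forall>\<omega>. (\<forall>e\<in>lattice_edges. 0 \<le> \<omega> e) \<longrightarrow>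
      (\<forall>e \<in> ball_edges n - ball_edges M - fast. \<sigma>1 \<le> \<omega> e) \<longrightarrow>
      (\<forall>x \<in> fpp_ball \<omega> t. \<exists>y\<in>K. dist (x /\<^sub>R t) y \<le> 6 * \<delta>)"
    unfolding fast_def
    by (rule fpp_ball_near[OF K0 bK inK[OF par(13)] \<delta> par(12,5) M(1) t(2) par(11,10) t(3) t'])
  obtain L2 where L2: "\<forall>n\<ge>L2. \<forall>\<omega>. (\<forall>e\<in>lattice_edges. 0 \<le> \<omega> e) \<longrightarrow> (\<forall>e\<in>ball_edges M. \<omega> e \<le> c) \<longrightarrow>
      (\<forall>e \<in> ball_edges n - ball_edges M. \<omega> e \<le> (if e \<in> fast then \<eta>2 else \<sigma>2)) \<longrightarrow>
      (\<forall>m p. polygon_in K \<delta> m p \<longrightarrow> c * of_int M + \<sigma>2 * (\<rho> * t + 1) +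
        \<eta>2 * (t * (\<Sum>i<m. l1_norm (p (Suc i) - p i)) + real CARD('d) * real m) \<le> t \<longrightarrow>
        t *\<^sub>R p m \<in> fpp_ball \<omega> t)"
    unfolding fast_def
    by (rule polygon_end_in_fpp_ball[OF bK \<delta> par(8) \<eta>2 par(4) M(1) c t(2,4)])
  define n where "n = max L1 L2"
  \<comment> \<open>Inner and fast edges need only upper bounds. Slow edges are bounded below for
    confinement and above for reaching \<open>K\<close>. Beyond the box nothing is imposed, which
    keeps the cylinder open.\<close>
  define Z where "Z e = (if e \<in> ball_edges M then {..<c}
    else if e \<notin> ball_edges n then UNIV else if e \<in> fast then {..<\<eta>2} else {\<sigma>1<..<\<sigma>2})" for e
  define V where "V = PiE lattice_edges (\<lambda>e. if e \<in> lattice_edges then A \<inter> Z e else A)"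
  show thesis
  proof (rule that[of V])
    show "openin (config_space A) V"
      unfolding config_space_def V_def
    proof (rule product_topology_basis)
      show "openin (top_of_set A) (if e \<in> lattice_edges then A \<inter> Z e else A)" for e
        by (auto simp: Z_def intro!: openin_open_Int)
      show "finite {e. (if e \<in> lattice_edges then A \<inter> Z e else A) \<noteq> topspace (top_of_set A)}"
        by (rule finite_subset[of _ "ball_edges M \<union> ball_edges n"])
          (auto simp: Z_def finite_ball_edges split: if_splits)
    qed
  next
    define \<omega>1 where "\<omega>1 = restrict (\<lambda>e. if e \<in> ball_edges M then \<omega>0 e else if e \<in> fast then \<eta> else \<sigma>) lattice_edges"
    have "\<omega>1 \<in> V" unfolding V_def \<omega>1_def
      using \<omega>0A \<omega>0c par by (auto simp: Z_def PiE_mem)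
    moreover have "\<omega>1 \<in> PiE lattice_edges W"
    proof (rule PiE_I)
      fix e :: "(int ^ 'd) set" assume e: "e \<in> lattice_edges"
      show "\<omega>1 e \<in> W e"
      proof (cases "e \<in> ball_edges M")
        case True
        then show ?thesis using e W(2) by (auto simp: \<omega>1_def PiE_mem)
      next
        case False
        then have "W e = A" using M(2) e by auto
        then show ?thesis using e False par by (simp add: \<omega>1_def)
      qed
    qed (simp add: \<omega>1_def)
    ultimately show "V \<inter> U \<noteq> {}" using W(3) by auto
  next
    fix \<omega> assume "\<omega> \<in> V"
    then have \<omega>: "\<omega> e \<in> A \<inter> Z e" if "e \<in> lattice_edges" for e
      using that by (auto simp: V_def PiE_def Pi_def)
    have nonneg: "0 \<le> \<omega> e" if "e \<in> lattice_edges" for e using \<omega>[OF that] A(1) by auto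
    have inner: "\<omega> e \<le> c" if "e \<in> ball_edges M" for e
      using \<omega>[of e] that ball_edges_subset[of M] by (auto simp: Z_def)
    have low: "\<sigma>1 \<le> \<omega> e" if "e \<in> ball_edges n" "e \<notin> ball_edges M" "e \<notin> fast" for e
      using \<omega>[of e] that ball_edges_subset[of n] by (auto simp: Z_def)
    have up: "\<omega> e \<le> (if e \<in> fast then \<eta>2 else \<sigma>2)" if "e \<in> ball_edges n" "e \<notin> ball_edges M" for e
      using \<omega>[of e] that ball_edges_subset[of n] by (auto simp: Z_def split: if_splits)
    have "\<exists>y\<in>K. dist (x /\<^sub>R t) y \<le> \<epsilon>" if "x \<in> fpp_ball \<omega> t" for x
      using L1[rule_format, of n \<omega> x] nonneg low that by (simp add: n_def \<delta>_def)
    moreover have "\<exists>x\<in>fpp_ball \<omega> t. dist (x /\<^sub>R t) y \<le> \<epsilon>" if "y \<in> K" for y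
    proof -
      obtain x where x: "x \<in> X" "dist x y < \<delta>" using X(3) \<open>y \<in> K\<close> by auto
      define s where "s = (\<Sum>i<m x. l1_norm (p x (Suc i) - p x i))"
      have "\<eta>2 * (t * s) \<le> \<eta>2 * (t * l)"
        using bspec[OF p(4) x(1)] \<eta>2 t(2) by (intro mult_left_mono) (auto simp: s_def)
      then have "c * of_int M + \<sigma>2 * (\<rho> * t + 1) + \<eta>2 * (t * s + real CARD('d) * real (m x)) \<le> t"
        using bspec[OF t(5) x(1)] by (simp add: algebra_simps)
      then have "t *\<^sub>R p x (m x) \<in> fpp_ball \<omega> t"
        using bspec[OF p(4) x(1)] unfolding s_def
        by (intro L2[rule_format, of n]) (use nonneg inner up in \<open>auto simp: n_def\<close>)
      then have "t *\<^sub>R x \<in> fpp_ball \<omega> t" using bspec[OF p(4) x(1)] by simp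
      moreover have "dist ((t *\<^sub>R x) /\<^sub>R t) y \<le> \<epsilon>" using x(2) t(2) \<open>0 < \<epsilon>\<close> by (simp add: \<delta>_def)
      ultimately show ?thesis by blast
    qed
    ultimately have "hclose \<epsilon> ((\<lambda>x. x /\<^sub>R t) ` fpp_ball \<omega> t) K" by (auto simp: hclose_def)
    then show "\<exists>t\<ge>N. 0 < t \<and> hclose \<epsilon> ((\<lambda>x. x /\<^sub>R t) ` fpp_ball \<omega> t) K" using t by blast
  qed
qed

theorem theorem1p5:
  fixes A :: "real set"
  assumes "A \<subseteq> {0..}"
    and "\<exists>a\<in>A. \<exists>b\<in>A. a \<noteq> b"
    and "(INF a\<in>A. ereal a) = 0 \<or> (SUP a\<in>A. ereal a) = \<infinity>"
  shows "\<exists>R :: ((int ^ 'd::finite) set \<Rightarrow> real) set. residual_in (config_space A) R \<and>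
    (\<forall>\<omega>\<in>R. \<forall>K \<in> P_closure A. \<exists>t :: nat \<Rightarrow> real.
       (\<forall>n. 0 < t n) \<and> filterlim t at_top sequentially \<and>
       (\<lambda>n. hausdorff_dist ((\<lambda>x. x /\<^sub>R t n) ` fpp_ball \<omega> (t n)) K) \<longlonglongrightarrow> 0)"
proof -
  define err :: "nat \<Rightarrow> real" where "err n = 1 / real (Suc n)" for n
  have err: "0 < err n" for n by (simp add: err_def)
  define B where "B \<omega> t = (\<lambda>x :: real ^ 'd. x /\<^sub>R t) ` fpp_ball \<omega> t" for \<omega> t
  obtain D :: "(real ^ 'd) set" where D: "countable D" "\<And>S. \<lbrakk>open S; S \<noteq> {}\<rbrakk> \<Longrightarrow> \<exists>d\<in>D. d \<in> S"
    using countable_dense_setE by blast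
  \<comment> \<open>One residual set must serve all \<open>K\<close> at once, so the conditions are
    indexed by finite sets \<open>F\<close> of points of \<open>D\<close>. Such an \<open>F\<close>
    need not belong to \<open>P_sets A\<close>; it only has to approximate some member.\<close>
  define I where "I = {(F, n). finite F \<and> F \<subseteq> D \<and> (\<exists>L\<in>P_sets A. hclose (err n) L F)}"
  define G where "G i = {\<omega>. \<exists>t\<ge>real (snd i). 0 < t \<and> hclose (2 * err (snd i)) (B \<omega> t) (fst i)}" for i
  have "countable I"
  proof (rule countable_subset)
    show "I \<subseteq> {F. finite F \<and> F \<subseteq> D} \<times> UNIV" by (auto simp: I_def)
    show "countable ({F. finite F \<and> F \<subseteq> D} \<times> (UNIV :: nat set))"
      by (intro countable_SIGMA countable_Collect_finite_subset D) auto
  qed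
  moreover have "\<exists>V. openin (config_space A) V \<and> V \<inter> U \<noteq> {} \<and> V \<subseteq> G i"
    if i: "i \<in> I" and U: "openin (config_space A) U" "U \<noteq> {}" for i U
  proof -
    obtain F n where Fn: "i = (F, n)" by (cases i)
    then obtain L where L: "L \<in> P_sets A" "hclose (err n) L F" using i by (auto simp: I_def)
    obtain V where V: "openin (config_space A) V" "V \<inter> U \<noteq> {}"
      "\<And>\<omega>. \<omega> \<in> V \<Longrightarrow> \<exists>t\<ge>real n. 0 < t \<and> hclose (err n) (B \<omega> t) L"
      using fpp_ball_close_on_dense_open[OF assms L(1) err U] unfolding B_def by metis
    have "V \<subseteq> G i" using V(3) hclose_trans[OF _ L(2)] by (fastforce simp: G_def Fn)
    then show ?thesis using V by blast
  qed
  ultimately obtain R where R: "residual_in (config_space A) R" "\<And>i. i \<in> I \<Longrightarrow> R \<subseteq> G i"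
    using residual_if_dense_open_cores[of I "config_space A" G] by blast
  show ?thesis
  proof (intro exI[of _ R] conjI ballI R(1))
    fix \<omega> and K :: "(real ^ 'd) set"
    assume \<omega>: "\<omega> \<in> R" and K: "K \<in> P_closure A"
    have "A \<noteq> {}" using assms(2) by auto
    then have zero: "0 \<in> L" if "L \<in> K_sets A" for L :: "(real ^ 'd) set"
      using zero_in_K_sets[OF assms(1) _ that] by simp
    have K0: "K \<noteq> {}" using K zero by (auto simp: P_closure_def)
    \<comment> \<open>The factor 4 counts two errors from the rescaled ball to \<open>F\<close>, one
      from \<open>F\<close> to \<open>L\<close> and one from \<open>L\<close> to \<open>K\<close>.
      The bound \<open>t \<ge> n\<close> later makes the times tend to infinity.\<close>
    have "\<exists>t\<ge>real n. 0 < t \<and> hclose (4 * err n) (B \<omega> t) K" for n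
    proof -
      obtain L where L: "L \<in> P_sets A" "hausdorff_dist L K < ereal (err n)"
        using K err unfolding P_closure_def by blast
      have LK: "L \<in> K_sets A" using L by (simp add: P_sets_def)
      then have "hclose (err n) L K"
        using L(2) zero K0 by (intro hclose_if_hausdorff_dist_less) auto
      moreover obtain F where F: "finite F" "F \<subseteq> D" "hclose (err n) L F"
      proof -
        have "compact L" using LK by (simp add: K_sets_def)
        then obtain Y where Y: "finite Y" "Y \<subseteq> L" "L \<subseteq> (\<Union>y\<in>Y. ball y (err n / 2))"
          using compactE_image[of L L "\<lambda>y. ball y (err n / 2)"] err[of n] by force
        have "\<exists>d\<in>D. dist y d < err n / 2" for y
          using D(2)[of "ball y (err n / 2)"] err[of n] by auto
        then obtain q where q: "\<And>y. q y \<in> D" "\<And>y. dist y (q y) < err n / 2" by metis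
        have "\<exists>z\<in>q ` Y. dist x z \<le> err n" if x: "x \<in> L" for x
        proof -
          obtain y where "y \<in> Y" "dist y x < err n / 2" using Y(3) x by auto
          then show ?thesis using q(2)[of y] dist_triangle[of x "q y" y]
            by (intro bexI[of _ "q y"]) (auto simp: dist_commute)
        qed
        moreover have "\<exists>x\<in>L. dist x z \<le> err n" if "z \<in> q ` Y" for z
          using that Y(2) q(2) err[of n] by (smt (verit) imageE subsetD field_sum_of_halves)
        ultimately have "hclose (err n) L (q ` Y)" by (simp add: hclose_def)
        then show thesis using q(1) Y(1) by (intro that[of "q ` Y"]) auto
      qed
      moreover have "(F, n) \<in> I" using F L by (auto simp: I_def)
      then obtain t where t: "real n \<le> t" "0 < t" "hclose (2 * err n) (B \<omega> t) F"
        using R(2) \<omega> by (fastforce simp: G_def)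
      ultimately have "hclose (2 * err n + err n + err n) (B \<omega> t) K"
        by (blast intro: hclose_trans hclose_sym)
      then show ?thesis using t by (auto intro!: exI[of _ t])
    qed
    then obtain t where t: "\<And>n. real n \<le> t n" "\<And>n. 0 < t n" "\<And>n. hclose (4 * err n) (B \<omega> (t n)) K"
      by metis
    have "filterlim t at_top sequentially"
      using t(1) by (intro filterlim_at_top_mono[OF filterlim_real_sequentially]) auto
    moreover have "(\<lambda>n. hausdorff_dist (B \<omega> (t n)) K) \<longlonglongrightarrow> 0"
    proof (rule tendsto_sandwich)
      show "\<forall>\<^sub>F n in sequentially. 0 \<le> hausdorff_dist (B \<omega> (t n)) K"
        using hausdorff_dist_nonneg[OF K0] by simp
      show "\<forall>\<^sub>F n in sequentially. hausdorff_dist (B \<omega> (t n)) K \<le> ereal (4 * err n)"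
        using hausdorff_dist_le_if_hclose[OF t(3)] by simp
      have "(\<lambda>n. 4 * err n) \<longlonglongrightarrow> 4 * 0"
        unfolding err_def using LIMSEQ_Suc[OF lim_1_over_n] by (intro tendsto_mult) auto
      then show "(\<lambda>n. ereal (4 * err n)) \<longlonglongrightarrow> 0" by (simp add: zero_ereal_def)
    qed simp
    ultimately show "\<exists>t. (\<forall>n. 0 < t n) \<and> filterlim t at_top sequentially \<and>
       (\<lambda>n. hausdorff_dist ((\<lambda>x. x /\<^sub>R t n) ` fpp_ball \<omega> (t n)) K) \<longlonglongrightarrow> 0"
      using t(2) unfolding B_def by blast
  qed
qed

end
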